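(* Let $n,s,d,\Delta\ge1$. There exists a set $H_{s,n,d,\Delta}\subseteq\mathbb{F}^n$ such that for any unambiguous circuit $\Psi$ of size $s$ and product depth $\Delta$ computing a non-zero polynomial $f\in\mathbb{F}[z_1,\ldots,z_n]$ of degree $\le d$, $f$ is non-zero at some point of $H_{s,n,d,\Delta}$. Furthermore, $|H_{s,n,d,\Delta}|=(nds)^{O(\Delta)}$ and $H_{s,n,d,\Delta}$ can be constructed in time $(nds)^{O(\Delta)}$.
   Context: Throughout, the field $\mathbb{F}$ is assumed to be sufficiently large. $\mathbb{F}[Z]$, $Z=\{z_1,\ldots,z_n\}$, is the usual commutative, associative polynomial ring. An arithmetic circuit is a DAG whose leaves are labeled by variables or field elements and whose internal gates are sum or fan-in-$2$ product gates; size = number of gates; product depth = maximum number of product gates on a leaf-to-root path. Parse trees of a circuit rooted at a gate $g$ are defined inductively: a leaf has itself as unique parse tree; if $g$ is a sum gate with children $g_1,g_2$, a parse tree is $g$ with a parse tree of $g_1$ or of $g_2$ attached; if $g$ is a product gate with children $g_1,g_2$, a parse tree is $g$ with a parse tree of $g_1$ and a parse tree of (a disjoint copy of) $g_2$ as children. A reduced parse tree is obtained from a parse tree by short-circuiting sum gates, removing leaves labeled by constants, and contracting nodes left with a single child; it is a full binary tree whose leaves are labeled by variables and whose internal nodes are product gates, and it generates the monomial equal to the product of its leaf labels. A circuit $\Psi$ is unambiguous if for every monomial $m$ there is a tree $T_m$ such that every reduced parse tree generating $m$ at any gate of $\Psi$ is identical to $T_m$ as a labeled rooted binary tree. *)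

theory Defs
  imports "HOL-Algebra.Indexed_Polynomials"
begin

section \<open>Polynomials in several variables\<close>

text \<open>As in \<^theory>\<open>HOL-Algebra.Indexed_Polynomials\<close>, a polynomial over \<open>R\<close> is its coefficient
  function on monomials, and a monomial is the multiset of its variables. The variables
  \<open>z\<^sub>1, \<dots>, z\<^sub>n\<close> are numbered \<open>0, \<dots>, n - 1\<close>. That theory only multiplies a polynomial by a
  variable; the product of two polynomials and the evaluation at a point are added here.\<close>

type_synonym 'a mpoly = "nat multiset \<Rightarrow> 'a"

definition mpoly_mult :: "'a ring \<Rightarrow> 'a mpoly \<Rightarrow> 'a mpoly \<Rightarrow> 'a mpoly" where
  "mpoly_mult R f g = (\<lambda>m. \<Oplus>\<^bsub>R\<^esub>a\<in>{a. a \<subseteq># m}. f a \<otimes>\<^bsub>R\<^esub> g (m - a))"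

definition mpoly_eval :: "'a ring \<Rightarrow> 'a list \<Rightarrow> 'a mpoly \<Rightarrow> 'a" where
  "mpoly_eval R p f =
     (\<Oplus>\<^bsub>R\<^esub>m\<in>{m. f m \<noteq> \<zero>\<^bsub>R\<^esub>}. f m \<otimes>\<^bsub>R\<^esub> (\<Otimes>\<^bsub>R\<^esub>i\<in>set_mset m. (p ! i) [^]\<^bsub>R\<^esub> count m i))"

definition mpoly_nonzero :: "'a ring \<Rightarrow> 'a mpoly \<Rightarrow> bool" where
  "mpoly_nonzero R f \<longleftrightarrow> (\<exists>m. f m \<noteq> \<zero>\<^bsub>R\<^esub>)"

definition mpoly_degree_le :: "'a ring \<Rightarrow> 'a mpoly \<Rightarrow> nat \<Rightarrow> bool" where
  "mpoly_degree_le R f d \<longleftrightarrow> (\<forall>m. f m \<noteq> \<zero>\<^bsub>R\<^esub> \<longrightarrow> size m \<le> d)"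

definition points :: "'a ring \<Rightarrow> nat \<Rightarrow> 'a list set" where
  "points R n = {p. length p = n \<and> set p \<subseteq> carrier R}"


section \<open>Arithmetic circuits\<close>

text \<open>The nodes of the DAG are listed in a topological order, and a gate refers to its children by
  their positions in the list. Sum gates have arbitrary positive fan-in, product gates have fan-in
  two. Children may be repeated, that is, parallel edges are allowed.\<close>

datatype 'a gate = Var nat | Const 'a | Plus "nat list" | Times nat nat

datatype 'a circuit = Circuit (gates: "'a gate list") (out_gate: nat)

definition is_circuit :: "'a ring \<Rightarrow> nat \<Rightarrow> 'a circuit \<Rightarrow> bool" where
  "is_circuit R n \<Psi> \<longleftrightarrow> out_gate \<Psi> < length (gates \<Psi>) \<and>
     (\<forall>i < length (gates \<Psi>). case gates \<Psi> ! i of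
        Var j \<Rightarrow> j < n
      | Const a \<Rightarrow> a \<in> carrier R
      | Plus js \<Rightarrow> js \<noteq> [] \<and> (\<forall>j\<in>set js. j < i)
      | Times j k \<Rightarrow> j < i \<and> k < i)"

text \<open>Leaves count as gates.\<close>

definition circuit_size :: "'a circuit \<Rightarrow> nat" where
  "circuit_size \<Psi> = length (gates \<Psi>)"

text \<open>Bottom-up evaluation: \<open>\<phi> vs g\<close> is the value of the gate \<open>g\<close>, given the list \<open>vs\<close> of the
  values of all earlier gates.\<close>

definition gate_values :: "('b list \<Rightarrow> 'a gate \<Rightarrow> 'b) \<Rightarrow> 'a gate list \<Rightarrow> 'b list" where
  "gate_values \<phi> gs = foldl (\<lambda>vs g. vs @ [\<phi> vs g]) [] gs"

fun gate_poly :: "'a ring \<Rightarrow> 'a mpoly list \<Rightarrow> 'a gate \<Rightarrow> 'a mpoly" where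
  "gate_poly R vs (Var i) = ring.indexed_var R i"
| "gate_poly R vs (Const a) = ring.indexed_const R a"
| "gate_poly R vs (Plus js) =
     foldr (ring.indexed_padd R) (map ((!) vs) js) (ring.indexed_const R \<zero>\<^bsub>R\<^esub>)"
| "gate_poly R vs (Times j k) = mpoly_mult R (vs ! j) (vs ! k)"

definition circuit_poly :: "'a ring \<Rightarrow> 'a circuit \<Rightarrow> 'a mpoly" where
  "circuit_poly R \<Psi> = gate_values (gate_poly R) (gates \<Psi>) ! out_gate \<Psi>"

text \<open>The maximal number of product gates on a path from a leaf to the given gate.\<close>

fun gate_depth :: "nat list \<Rightarrow> 'a gate \<Rightarrow> nat" where
  "gate_depth vs (Var i) = 0"
| "gate_depth vs (Const a) = 0"
| "gate_depth vs (Plus js) = Max ((!) vs ` set js)"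
| "gate_depth vs (Times j k) = Suc (max (vs ! j) (vs ! k))"

definition product_depth :: "'a circuit \<Rightarrow> nat" where
  "product_depth \<Psi> = gate_values gate_depth (gates \<Psi>) ! out_gate \<Psi>"


section \<open>Parse trees and unambiguous circuits\<close>

text \<open>The nodes of a parse tree carry the (number of the) gate they are a copy of.\<close>

datatype parse_tree = Leaf nat | Sum_Node nat parse_tree | Prod_Node nat parse_tree parse_tree

inductive is_parse_tree :: "'a gate list \<Rightarrow> nat \<Rightarrow> parse_tree \<Rightarrow> bool" for gs where
  var: "\<lbrakk> g < length gs; gs ! g = Var i \<rbrakk> \<Longrightarrow> is_parse_tree gs g (Leaf g)"
| const: "\<lbrakk> g < length gs; gs ! g = Const a \<rbrakk> \<Longrightarrow> is_parse_tree gs g (Leaf g)"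
| plus: "\<lbrakk> g < length gs; gs ! g = Plus js; j \<in> set js; is_parse_tree gs j t \<rbrakk>
    \<Longrightarrow> is_parse_tree gs g (Sum_Node g t)"
| times: "\<lbrakk> g < length gs; gs ! g = Times j k; is_parse_tree gs j t; is_parse_tree gs k u \<rbrakk>
    \<Longrightarrow> is_parse_tree gs g (Prod_Node g t u)"

datatype reduced_tree = RLeaf nat | RNode reduced_tree reduced_tree

text \<open>A parse tree all of whose leaves are constants reduces to the empty tree \<open>None\<close>.\<close>

fun reduce :: "'a gate list \<Rightarrow> parse_tree \<Rightarrow> reduced_tree option" where
  "reduce gs (Leaf g) = (case gs ! g of Var i \<Rightarrow> Some (RLeaf i) | _ \<Rightarrow> None)"
| "reduce gs (Sum_Node g t) = reduce gs t"
| "reduce gs (Prod_Node g t u) = (case (reduce gs t, reduce gs u) of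
     (None, r) \<Rightarrow> r
   | (r, None) \<Rightarrow> r
   | (Some a, Some b) \<Rightarrow> Some (RNode a b))"

fun tree_monom :: "reduced_tree \<Rightarrow> nat multiset" where
  "tree_monom (RLeaf i) = {#i#}"
| "tree_monom (RNode a b) = tree_monom a + tree_monom b"

definition generated_monom :: "reduced_tree option \<Rightarrow> nat multiset" where
  "generated_monom r = (case r of None \<Rightarrow> {#} | Some a \<Rightarrow> tree_monom a)"

text \<open>Multiplication being commutative, the two children of a node are unordered. The datatype
  \<^typ>\<open>reduced_tree\<close> orders them, so trees are compared up to exchanging children.\<close>

inductive same_tree :: "reduced_tree \<Rightarrow> reduced_tree \<Rightarrow> bool" where
  leaf: "same_tree (RLeaf i) (RLeaf i)"
| node: "\<lbrakk> same_tree a a'; same_tree b b' \<rbrakk> \<Longrightarrow> same_tree (RNode a b) (RNode a' b')"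
| swap: "\<lbrakk> same_tree a a'; same_tree b b' \<rbrakk> \<Longrightarrow> same_tree (RNode a b) (RNode b' a')"

definition unambiguous :: "'a circuit \<Rightarrow> bool" where
  "unambiguous \<Psi> \<longleftrightarrow> (\<forall>m. \<exists>T. \<forall>g < length (gates \<Psi>). \<forall>t.
     is_parse_tree (gates \<Psi>) g t \<and> generated_monom (reduce (gates \<Psi>) t) = m \<longrightarrow>
     rel_option same_tree (reduce (gates \<Psi>) t) T)"


section \<open>Construction time\<close>

text \<open>The model of computation is a RAM over a field \<open>R\<close>, presented as a structured language. It
  has a memory of natural numbers and a memory of field elements, both with indirect
  addressing, and an output tape of field elements. Every operation on numbers or field elements
  costs one unit. On natural numbers there are only constants, addition, truncated subtraction
  and comparison, so \<open>t\<close> steps produce numbers of \<open>O(t)\<close> bits only and unit cost is polynomially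
  equivalent to bit cost. As a field has no canonical listing of its elements, the machine is given
  one: \<open>Elem a\<close> is the element number \<open>a\<close> in a sequence \<open>e\<close> of distinct elements.\<close>

datatype nexp = Num nat | Mem nexp | NAdd nexp nexp | NSub nexp nexp

datatype fexp = FMem nexp | Elem nexp | FZero | FOne
  | FAdd fexp fexp | FSub fexp fexp | FMul fexp fexp | FInv fexp

datatype bexp = NLess nexp nexp | FEq fexp fexp

datatype cmd = Skip
  | NAssign nexp nexp  \<comment> \<open>address, value\<close>
  | FAssign nexp fexp
  | Emit fexp
  | Seq cmd cmd
  | Cond bexp cmd cmd
  | While bexp cmd

record 'a state =
  nmem :: "nat \<Rightarrow> nat"
  fmem :: "nat \<Rightarrow> 'a"
  tape :: "'a list"

fun nval :: "'a state \<Rightarrow> nexp \<Rightarrow> nat" where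
  "nval \<sigma> (Num k) = k"
| "nval \<sigma> (Mem a) = nmem \<sigma> (nval \<sigma> a)"
| "nval \<sigma> (NAdd a b) = nval \<sigma> a + nval \<sigma> b"
| "nval \<sigma> (NSub a b) = nval \<sigma> a - nval \<sigma> b"

fun fval :: "'a ring \<Rightarrow> (nat \<Rightarrow> 'a) \<Rightarrow> 'a state \<Rightarrow> fexp \<Rightarrow> 'a" where
  "fval R e \<sigma> (FMem a) = fmem \<sigma> (nval \<sigma> a)"
| "fval R e \<sigma> (Elem a) = e (nval \<sigma> a)"
| "fval R e \<sigma> FZero = \<zero>\<^bsub>R\<^esub>"
| "fval R e \<sigma> FOne = \<one>\<^bsub>R\<^esub>"
| "fval R e \<sigma> (FAdd x y) = fval R e \<sigma> x \<oplus>\<^bsub>R\<^esub> fval R e \<sigma> y"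
| "fval R e \<sigma> (FSub x y) = fval R e \<sigma> x \<ominus>\<^bsub>R\<^esub> fval R e \<sigma> y"
| "fval R e \<sigma> (FMul x y) = fval R e \<sigma> x \<otimes>\<^bsub>R\<^esub> fval R e \<sigma> y"
| "fval R e \<sigma> (FInv x) =
     (if fval R e \<sigma> x = \<zero>\<^bsub>R\<^esub> then \<zero>\<^bsub>R\<^esub> else inv\<^bsub>R\<^esub> (fval R e \<sigma> x))"

fun bval :: "'a ring \<Rightarrow> (nat \<Rightarrow> 'a) \<Rightarrow> 'a state \<Rightarrow> bexp \<Rightarrow> bool" where
  "bval R e \<sigma> (NLess a b) \<longleftrightarrow> nval \<sigma> a < nval \<sigma> b"
| "bval R e \<sigma> (FEq x y) \<longleftrightarrow> fval R e \<sigma> x = fval R e \<sigma> y"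

fun ncost :: "nexp \<Rightarrow> nat" where
  "ncost (Num k) = 1"
| "ncost (Mem a) = 1 + ncost a"
| "ncost (NAdd a b) = 1 + ncost a + ncost b"
| "ncost (NSub a b) = 1 + ncost a + ncost b"

fun fcost :: "fexp \<Rightarrow> nat" where
  "fcost (FMem a) = 1 + ncost a"
| "fcost (Elem a) = 1 + ncost a"
| "fcost FZero = 1"
| "fcost FOne = 1"
| "fcost (FAdd x y) = 1 + fcost x + fcost y"
| "fcost (FSub x y) = 1 + fcost x + fcost y"
| "fcost (FMul x y) = 1 + fcost x + fcost y"
| "fcost (FInv x) = 1 + fcost x"

fun bcost :: "bexp \<Rightarrow> nat" where
  "bcost (NLess a b) = 1 + ncost a + ncost b"
| "bcost (FEq x y) = 1 + fcost x + fcost y"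

text \<open>\<open>exec R e c \<sigma> t \<sigma>'\<close>: started in \<open>\<sigma>\<close>, the command \<open>c\<close> halts in \<open>\<sigma>'\<close> after time \<open>t\<close>.\<close>

inductive exec :: "'a ring \<Rightarrow> (nat \<Rightarrow> 'a) \<Rightarrow> cmd \<Rightarrow> 'a state \<Rightarrow> nat \<Rightarrow> 'a state \<Rightarrow> bool"
  for R e where
  Skip: "exec R e Skip \<sigma> 1 \<sigma>"
| NAssign: "exec R e (NAssign a b) \<sigma> (1 + ncost a + ncost b)
    (\<sigma>\<lparr>nmem := (nmem \<sigma>)(nval \<sigma> a := nval \<sigma> b)\<rparr>)"
| FAssign: "exec R e (FAssign a x) \<sigma> (1 + ncost a + fcost x)
    (\<sigma>\<lparr>fmem := (fmem \<sigma>)(nval \<sigma> a := fval R e \<sigma> x)\<rparr>)"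
| Emit: "exec R e (Emit x) \<sigma> (1 + fcost x) (\<sigma>\<lparr>tape := tape \<sigma> @ [fval R e \<sigma> x]\<rparr>)"
| Seq: "\<lbrakk> exec R e c \<sigma> t \<sigma>'; exec R e c' \<sigma>' t' \<sigma>'' \<rbrakk> \<Longrightarrow> exec R e (Seq c c') \<sigma> (t + t') \<sigma>''"
| CondTrue: "\<lbrakk> bval R e \<sigma> b; exec R e c \<sigma> t \<sigma>' \<rbrakk> \<Longrightarrow> exec R e (Cond b c c') \<sigma> (1 + bcost b + t) \<sigma>'"
| CondFalse: "\<lbrakk> \<not> bval R e \<sigma> b; exec R e c' \<sigma> t \<sigma>' \<rbrakk> \<Longrightarrow> exec R e (Cond b c c') \<sigma> (1 + bcost b + t) \<sigma>'"
| WhileFalse: "\<not> bval R e \<sigma> b \<Longrightarrow> exec R e (While b c) \<sigma> (1 + bcost b) \<sigma>"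
| WhileTrue: "\<lbrakk> bval R e \<sigma> b; exec R e c \<sigma> t \<sigma>'; exec R e (While b c) \<sigma>' t' \<sigma>'' \<rbrakk>
    \<Longrightarrow> exec R e (While b c) \<sigma> (1 + bcost b + t + t') \<sigma>''"

definition input_state :: "'a ring \<Rightarrow> nat list \<Rightarrow> 'a state" where
  "input_state R xs =
     \<lparr>nmem = (\<lambda>i. if i < length xs then xs ! i else 0), fmem = (\<lambda>_. \<zero>\<^bsub>R\<^esub>), tape = []\<rparr>"

text \<open>On input \<open>xs\<close> the program outputs the points of \<open>H\<close>, one after the other, each as the
  sequence of its \<open>n\<close> coordinates, and halts after at most \<open>B\<close> steps.\<close>

definition constructs_within ::
    "'a ring \<Rightarrow> (nat \<Rightarrow> 'a) \<Rightarrow> cmd \<Rightarrow> nat list \<Rightarrow> nat \<Rightarrow> 'a list set \<Rightarrow> nat \<Rightarrow> bool" where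
  "constructs_within R e P xs n H B \<longleftrightarrow> (\<exists>t \<sigma> ps. exec R e P (input_state R xs) t \<sigma> \<and> t \<le> B \<and>
     tape \<sigma> = concat ps \<and> (\<forall>p\<in>set ps. length p = n) \<and> H = set ps)"

text \<open>There is such a sequence \<open>e\<close> if and only if the carrier of \<open>R\<close> is infinite or has at least
  \<open>N\<close> elements, so the existence of \<open>e\<close> says that the field is large.\<close>

definition distinct_elements :: "'a ring \<Rightarrow> nat \<Rightarrow> (nat \<Rightarrow> 'a) \<Rightarrow> bool" where
  "distinct_elements R N e \<longleftrightarrow> inj_on e {..<N} \<and> e ` {..<N} \<subseteq> carrier R"

end

theory Submission
  imports Defs
begin

text \<open>For a monomial \<open>m\<close> let \<open>v\<^sub>m\<close> be the vector of its coefficients at all gates. In an unambiguous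
  circuit, if \<open>m\<close> is generated by a tree whose two subtrees generate \<open>a\<close> and \<open>b\<close>, then \<open>v\<^sub>m\<close> is a fixed
  symmetrised bilinear expression in \<open>v\<^sub>a\<close> and \<open>v\<^sub>b\<close>, and for any other pair \<open>a\<close>, \<open>b\<close> that expression
  vanishes. Hence linear dependencies between the \<open>v\<^sub>a\<close> propagate from subtrees to trees: if the
  vectors of the monomials of height at most \<open>k\<close> are spanned, by means of smaller weights only, by at
  most \<open>s\<close> of them, then at height \<open>k + 1\<close> the variables and the sums of two of these monomials
  suffice. Refining the weight so that these at most \<open>n + s\<^sup>2\<close> candidates get distinct weights and
  eliminating greedily again leaves at most \<open>s\<close> of them. After \<open>\<Delta> + 1\<close> rounds some monomial of \<open>f\<close> is
  the only one of its weight \<open>w\<close>, so \<open>f\<close> does not vanish on the curve \<open>t \<mapsto> (t ^ w i)\<^sub>i\<close>. A round only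
  chooses a small modulus \<open>p\<close>, the refinement being \<open>i \<mapsto> (d + 1) ^ i mod p\<close>.\<close>

text \<open>The number \<open>s\<close> of spanning monomials is the dimension of the space in which
  the vectors live: one coordinate per gate. Trees are unordered, so \<open>a\<close> may come from
  the left factor at one product gate and from the right factor at another. Only the sum of both
  contributions is a coefficient of the circuit; hence the symmetrisation. For \<open>a = b\<close>
  it counts every term twice, which loses everything in characteristic 2, so the quadratic case
  needs its own argument. Inner gates may carry monomials of degree far above \<open>d\<close> that
  cancel later, and no small weight separates those. They are kept out by starting from the degree
  as weight: each refinement is lexicographic, so passing to a lighter monomial never raises the
  degree. A choice of moduli for all rounds is encoded by one number below
  \<open>M ^ (\<Delta> + 1)\<close>. A program can therefore try all choices without knowing the
  circuit.\<close>

section \<open>Separating few monomials by small weights\<close>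

text \<open>The reciprocals of \<open>m * (n choose m)\<close> form the Leibniz harmonic triangle:
  the entry at \<open>(n, m + 1)\<close> is the entry at \<open>(n - 1, m)\<close> minus the one at
  \<open>(n, m)\<close>. So \<open>L\<close> times an entry stays an integer from one column to the
  next.\<close>

lemma leibniz_triangle_dvd:
  assumes "1 \<le> m" "m \<le> n" and "\<And>k. k \<in> {1..n} \<Longrightarrow> k dvd (L::nat)"
  shows "m * (n choose m) dvd L"
  using assms
proof (induction m arbitrary: n rule: nat_induct_at_least)
  case base
  then show ?case by simp
next
  case (Suc m)
  from Suc.prems obtain n' where n: "n = Suc n'" by (cases n) auto
  have 1: "m * (n choose m) dvd L" "m * (n' choose m) dvd L"
    using Suc n by auto
  obtain a b where a: "L = m * (n choose m) * a" and b: "L = m * (n' choose m) * b"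
    using 1 unfolding dvd_def by blast
  show ?case
  proof (cases "L = 0")
    case False
    define x y z where "x = n' choose m" and "y = n choose m" and "z = n choose Suc m"
    have xy: "(n - m) * y = n * x"
      using binomial_absorb_comp[of n m] n by (simp add: x_def y_def)
    have yz: "Suc m * z = n * x"
      using Suc_times_binomial_eq[of n' m] n by (simp add: x_def z_def mult.commute)
    have pos: "x > 0" "y > 0" "m > 0" "n > m"
      using Suc n by (auto simp: x_def y_def)
    have L: "L = m * y * a" "L = m * x * b" using a b by (auto simp: x_def y_def)
    have xb: "int x * int b = int y * int a"
      using arg_cong[OF L(1), of int] arg_cong[OF L(2), of int] pos by simp
    have "int n * int a * int y = int n * int x * int b" using xb by (simp add: ac_simps)
    also have "int n * int x = (int n - int m) * int y"
      using arg_cong[OF xy, of int] pos by (simp add: of_nat_diff)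
    finally have "(int n * int a) * int y = ((int n - int m) * int b) * int y"
      by (simp add: ac_simps)
    then have na: "int n * int a = (int n - int m) * int b"
      using pos by simp
    have "int n * int L = int n * int x * (int m * int b)"
      using L(2) by simp
    also have "\<dots> = int (Suc m * z) * (int m * int b)"
      using yz by simp
    also have "int m * int b = int n * (int b - int a)"
      using na by (simp add: algebra_simps)
    finally have "int n * int L = int n * (int (Suc m * z) * (int b - int a))" by (simp add: algebra_simps)
    then have "int L = int (Suc m * z) * (int b - int a)" using n by simp
    then have "int (Suc m * z) dvd int L" by (metis dvd_triv_left)
    then show ?thesis unfolding z_def by presburger
  qed simp
qed

text \<open>Otherwise \<open>D\<close> is a positive multiple of
  \<open>n * (2 * n choose n)\<close>, which is at least \<open>2 ^ n\<close>. Moduli need not be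
  prime, so no estimate on primes enters.\<close>

lemma exists_small_nondivisor:
  assumes "0 < D" "D < 2 ^ n" "1 \<le> n"
  shows "\<exists>p\<in>{2..2 * n}. \<not> p dvd (D::nat)"
proof (rule ccontr)
  assume "\<not> ?thesis"
  then have *: "k dvd D" if "k \<in> {1..2 * n}" for k
    using that by (cases "k = 1") auto
  have "n * (2 * n choose n) dvd D"
    using leibniz_triangle_dvd[of n "2 * n" D] * assms(3) by auto
  then have "n * (2 * n choose n) \<le> D" using assms(1) by (auto dest: dvd_imp_le)
  moreover have "(2 * n choose n) \<le> n * (2 * n choose n)" using assms(3) by simp
  moreover have "2 ^ n \<le> (2 * n choose n)"
  proof -
    have "(of_nat (2 * n) / of_nat n :: real) ^ n \<le> of_nat (2 * n choose n)"
      by (rule binomial_ge_n_over_k_pow_k) auto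
    then have "(2 ^ n :: real) \<le> of_nat (2 * n choose n)" using assms(3) by simp
    then show ?thesis by (metis of_nat_le_iff of_nat_numeral of_nat_power)
  qed
  ultimately show False using assms(2) by linarith
qed

section \<open>Weighted degrees and the Kronecker substitution\<close>

definition wdeg :: "(nat \<Rightarrow> nat) \<Rightarrow> nat multiset \<Rightarrow> nat" where
  "wdeg w m = (\<Sum>i\<in>#m. w i)"

lemma wdeg_simps [simp]:
  "wdeg w {#} = 0" "wdeg w (add_mset i m) = w i + wdeg w m" "wdeg w (a + b) = wdeg w a + wdeg w b"
  by (auto simp: wdeg_def)

lemma wdeg_le: "(\<And>i. i \<in># m \<Longrightarrow> w i \<le> W) \<Longrightarrow> wdeg w m \<le> W * size m"
  by (induction m) (auto simp: add_mono)

lemma wdeg_const [simp]: "wdeg (\<lambda>_. c) m = c * size m"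
  by (induction m) auto

lemma wdeg_affine: "wdeg (\<lambda>i. w i * K + u i) m = wdeg w m * K + wdeg u m"
  by (induction m) (auto simp: algebra_simps)

lemma wdeg_mod: "wdeg (\<lambda>i. w i mod p) m mod p = wdeg w m mod p"
proof (induction m)
  case (add x m)
  then show ?case by simp (metis mod_add_cong mod_mod_trivial)
qed simp

lemma wdeg_conv_sum: "set_mset m \<subseteq> {..<n} \<Longrightarrow> wdeg w m = (\<Sum>i<n. count m i * w i)"
proof (induction m)
  case (add x m)
  have "(\<Sum>i<n. count (add_mset x m) i * w i) = (\<Sum>i<n. (if i = x then w i else 0) + count m i * w i)"
    by (rule sum.cong) (auto simp: algebra_simps)
  also have "\<dots> = w x + wdeg w m"
    using add by (simp add: sum.distrib)
  finally show ?case by simp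
qed simp

lemma radix_digits_unique:
  fixes B :: nat
  assumes "\<And>i. i < n \<Longrightarrow> a i < B" "\<And>i. i < n \<Longrightarrow> b i < B"
    and "(\<Sum>i<n. a i * B ^ i) = (\<Sum>i<n. b i * B ^ i)" and "i < n"
  shows "a i = b i"
  using assms
proof (induction n arbitrary: a b i)
  case (Suc n)
  have s: "(\<Sum>i<Suc n. c i * B ^ i) = c 0 + B * (\<Sum>i<n. c (Suc i) * B ^ i)" for c
    by (subst sum.lessThan_Suc_shift) (simp add: sum_distrib_left algebra_simps)
  have eq: "a 0 + B * (\<Sum>i<n. a (Suc i) * B ^ i) = b 0 + B * (\<Sum>i<n. b (Suc i) * B ^ i)"
    using Suc.prems(3) unfolding s .
  have B: "a 0 < B" "b 0 < B" using Suc.prems by auto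
  have a0: "a 0 = b 0" using arg_cong[OF eq, of "\<lambda>x. x mod B"] B by simp
  have "B * (\<Sum>i<n. a (Suc i) * B ^ i) = B * (\<Sum>i<n. b (Suc i) * B ^ i)" using eq a0 by simp
  then have e: "(\<Sum>i<n. a (Suc i) * B ^ i) = (\<Sum>i<n. b (Suc i) * B ^ i)" using B by simp
  show ?case
  proof (cases i)
    case (Suc j)
    then show ?thesis using Suc.IH[OF _ _ e, of j] Suc.prems by auto
  qed (use a0 in simp)
qed simp

text \<open>Exponents of size at most \<open>d\<close> are digits in base \<open>d + 1\<close>, so
  the weight determines them.\<close>

lemma wdeg_radix_inj:
  assumes "wdeg (\<lambda>i. Suc d ^ i) a = wdeg (\<lambda>i. Suc d ^ i) b"
    and "set_mset a \<subseteq> {..<n}" "set_mset b \<subseteq> {..<n}" "size a \<le> d" "size b \<le> d"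
  shows "a = b"
proof (rule multiset_eqI)
  fix i
  have c: "count m i < Suc d" if "size m \<le> d" for m and i :: nat
    using that count_le_size[of m i] by linarith
  show "count a i = count b i"
  proof (cases "i < n")
    case True
    then show ?thesis
      using radix_digits_unique[of n "count a" "Suc d" "count b" i] assms c
      by (simp add: wdeg_conv_sum)
  next
    case False
    then have "i \<notin># a" "i \<notin># b" using assms by auto
    then show ?thesis by (simp add: not_in_iff)
  qed
qed

text \<open>The product of the pairwise differences of the Kronecker weights of the monomials in \<open>A\<close> is
  too small to be divisible by all small numbers.\<close>

lemma exists_separating_modulus:
  assumes fin: "finite A" and A: "\<And>a. a \<in> A \<Longrightarrow> set_mset a \<subseteq> {..<n} \<and> size a \<le> d"
    and card: "card A \<le> L" "1 \<le> L" and n: "1 \<le> n"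
  shows "\<exists>p\<in>{2..2 * (Suc d * n * L\<^sup>2)}. inj_on (wdeg (\<lambda>i. Suc d ^ i mod p)) A"
proof -
  define \<kappa> where "\<kappa> = wdeg (\<lambda>i. Suc d ^ i)"
  define I where "I = {(a, b) \<in> A \<times> A. a \<noteq> b}"
  \<comment> \<open>The absolute difference: one of the two truncated differences is zero.\<close>
  define df where "df = (\<lambda>(a, b). (\<kappa> a - \<kappa> b) + (\<kappa> b - \<kappa> a))"
  define D where "D = (\<Prod>ab\<in>I. df ab)"
  have finI: "finite I" using fin by (auto simp: I_def intro: finite_subset[of _ "A \<times> A"])
  have inj: "\<kappa> a \<noteq> \<kappa> b" if "(a, b) \<in> I" for a b
    using that wdeg_radix_inj[of d a b n] A by (auto simp: I_def \<kappa>_def)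
  have lt: "\<kappa> a < 2 ^ (Suc d * n)" if "a \<in> A" for a
  proof -
    have "\<kappa> a \<le> Suc d ^ (n - 1) * size a"
      unfolding \<kappa>_def using A[OF that] by (intro wdeg_le power_increasing) auto
    also have "\<dots> < Suc d ^ (n - 1) * Suc d"
      using A[OF that] by (intro mult_strict_left_mono) auto
    also have "\<dots> = Suc d ^ n" using n by (cases n) auto
    also have "\<dots> \<le> (2 ^ Suc d) ^ n"
      using less_exp[of "Suc d"] by (intro power_mono) (auto simp del: power_Suc)
    also have "\<dots> = 2 ^ (Suc d * n)" by (metis power_mult)
    finally show ?thesis .
  qed
  have D0: "0 < D" unfolding D_def using inj by (intro prod_pos) (fastforce simp: df_def)
  \<comment> \<open>There are at most \<open>L\<^sup>2\<close> ordered pairs, each with a difference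
    below \<open>2 ^ (Suc d * n)\<close>.\<close>
  have "D < 2 ^ (Suc d * n * L\<^sup>2)"
  proof (cases "I = {}")
    case True
    have "0 < Suc d * n * L\<^sup>2" using card n by simp
    then have "(1::nat) < 2 ^ (Suc d * n * L\<^sup>2)" by (intro one_less_power) auto
    then show ?thesis using True by (simp add: D_def)
  next
    case False
    have d: "df ab < 2 ^ (Suc d * n)" if "ab \<in> I" for ab
    proof -
      obtain a b where ab: "ab = (a, b)" by fastforce
      have "df ab \<le> max (\<kappa> a) (\<kappa> b)" by (simp add: df_def ab)
      also have "\<dots> < 2 ^ (Suc d * n)" using lt[of a] lt[of b] that by (auto simp: I_def ab)
      finally show ?thesis .
    qed
    from False obtain ab where "ab \<in> I" by blast
    then have "D < (\<Prod>ab\<in>I. 2 ^ (Suc d * n))"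
      unfolding D_def using finI d less_imp_le[OF d]
      by (intro prod_mono_strict[of ab]) (auto simp del: power_Suc mult_Suc)
    also have "\<dots> = 2 ^ (Suc d * n * card I)" by (simp add: power_mult del: power_Suc mult_Suc)
    also have "\<dots> \<le> 2 ^ (Suc d * n * L\<^sup>2)"
    proof -
      have "card I \<le> card (A \<times> A)" using fin by (intro card_mono) (auto simp: I_def)
      also have "\<dots> \<le> L\<^sup>2" using card by (simp add: card_cartesian_product power2_eq_square mult_mono)
      finally show ?thesis by (intro power_increasing mult_left_mono) auto
    qed
    finally show ?thesis .
  qed
  moreover have "1 \<le> Suc d * n * L\<^sup>2" using n card(2) by simp
  ultimately obtain p where p: "p \<in> {2..2 * (Suc d * n * L\<^sup>2)}" "\<not> p dvd D"
    using exists_small_nondivisor[OF D0] by blast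
  have "inj_on (wdeg (\<lambda>i. Suc d ^ i mod p)) A"
  proof (rule inj_onI, rule ccontr)
    fix a b assume ab: "a \<in> A" "b \<in> A" "wdeg (\<lambda>i. Suc d ^ i mod p) a = wdeg (\<lambda>i. Suc d ^ i mod p) b" "a \<noteq> b"
    then have "\<kappa> a mod p = \<kappa> b mod p" unfolding \<kappa>_def by (metis wdeg_mod)
    then have "p dvd \<kappa> a - \<kappa> b" "p dvd \<kappa> b - \<kappa> a"
      using nat_le_linear[of "\<kappa> a" "\<kappa> b"] mod_eq_dvd_iff_nat[of "\<kappa> a" "\<kappa> b" p]
        mod_eq_dvd_iff_nat[of "\<kappa> b" "\<kappa> a" p] by (metis diff_is_0_eq' dvd_0_right)+
    then have "p dvd df (a, b)" by (simp add: df_def)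
    moreover have "(a, b) \<in> I" using ab by (auto simp: I_def)
    ultimately show False using p(2) finI unfolding D_def by (meson dvd_prod_eqI dvd_prodI dvd_trans)
  qed
  then show ?thesis using p by blast
qed

section \<open>Linear spans and weighted bases\<close>

context ring
begin

text \<open>Generators are added one at a time, so that a statement about a linear map extends from
  the generators to the span by induction.\<close>

inductive_set lin_span :: "(nat \<Rightarrow> 'a) set \<Rightarrow> (nat \<Rightarrow> 'a) set" for W where
  zero: "(\<lambda>_. \<zero>) \<in> lin_span W"
| add: "\<lbrakk> u \<in> lin_span W; w \<in> W; c \<in> carrier R \<rbrakk> \<Longrightarrow> (\<lambda>g. u g \<oplus> c \<otimes> w g) \<in> lin_span W"

lemma lin_span_closed:
  assumes "u \<in> lin_span W" "W \<subseteq> UNIV \<rightarrow> carrier R"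
  shows "u g \<in> carrier R"
  using assms(1)
proof (induction rule: lin_span.induct)
  case (add u w c)
  then have "w g \<in> carrier R" using assms(2) by blast
  then show ?case using add by simp
qed simp

lemma lin_span_base:
  assumes "w \<in> W" "W \<subseteq> UNIV \<rightarrow> carrier R"
  shows "w \<in> lin_span W"
proof -
  have "w g \<in> carrier R" for g using assms by blast
  then show ?thesis using lin_span.add[OF lin_span.zero assms(1) one_closed] by simp
qed

lemma lin_span_add_smult:
  assumes "u \<in> lin_span W" "v \<in> lin_span W" "c \<in> carrier R" and W: "W \<subseteq> UNIV \<rightarrow> carrier R"
  shows "(\<lambda>g. u g \<oplus> c \<otimes> v g) \<in> lin_span W"
  using assms(2)
proof (induction rule: lin_span.induct)
  case zero
  have "(\<lambda>g. u g \<oplus> c \<otimes> \<zero>) = u" using assms(3) lin_span_closed[OF assms(1) W] by auto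
  then show ?case using assms(1) by simp
next
  case (add v w b)
  have [simp]: "w g \<in> carrier R" for g using add(2) W by blast
  have "(\<lambda>g. u g \<oplus> c \<otimes> (v g \<oplus> b \<otimes> w g)) = (\<lambda>g. (u g \<oplus> c \<otimes> v g) \<oplus> (c \<otimes> b) \<otimes> w g)"
    using add(3) assms(3) lin_span_closed[OF assms(1) W] lin_span_closed[OF add(1) W]
    by (auto simp: r_distr a_assoc m_assoc)
  then show ?case using lin_span.add[OF add(4,2), of "c \<otimes> b"] add(3) assms(3) by simp
qed

lemma lin_span_subset:
  assumes "u \<in> lin_span W" "W \<subseteq> lin_span W'" "W' \<subseteq> UNIV \<rightarrow> carrier R"
  shows "u \<in> lin_span W'"
  using assms(1)
proof (induction rule: lin_span.induct)
  case (add u w c)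
  then show ?case using assms(2) by (intro lin_span_add_smult[OF _ _ _ assms(3)]) auto
qed (rule lin_span.zero)

lemma lin_span_mono:
  assumes "u \<in> lin_span W" "W \<subseteq> W'" "W' \<subseteq> UNIV \<rightarrow> carrier R"
  shows "u \<in> lin_span W'"
  by (rule lin_span_subset[OF assms(1) _ assms(3)]) (use assms(2,3) in \<open>auto intro!: lin_span_base\<close>)

lemma lin_span_vanish:
  assumes "u \<in> lin_span W" "\<And>w. w \<in> W \<Longrightarrow> w g = \<zero>"
  shows "u g = \<zero>"
  using assms(1) by (induction rule: lin_span.induct) (auto simp: assms(2))

end

text \<open>Gaussian elimination, pivoting at each coordinate on the vector of least weight.\<close>

lemma (in field) exists_weight_basis:
  assumes "finite A" "inj_on w A" and "v ` A \<subseteq> UNIV \<rightarrow> carrier R"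
    and "\<And>a g. a \<in> A \<Longrightarrow> k \<le> g \<Longrightarrow> v a g = \<zero>"
  shows "\<exists>S\<subseteq>A. card S \<le> k \<and> (\<forall>c\<in>A. v c \<in> lin_span (v ` {a \<in> S. a = c \<or> w a < (w c :: nat)}))"
  using assms(3,4)
proof (induction k arbitrary: v)
  case 0
  then have "v c = (\<lambda>_. \<zero>)" if "c \<in> A" for c using that by blast
  then have "v c \<in> lin_span (v ` {a \<in> {}. a = c \<or> w a < w c})" if "c \<in> A" for c
    using that lin_span.zero by simp
  then show ?case by (intro exI[of _ "{}"]) simp
next
  case (Suc k)
  have V: "v a g \<in> carrier R" if "a \<in> A" for a g using Suc.prems(1) that by blast
  show ?case
  proof (cases "\<forall>a\<in>A. v a k = \<zero>")
    case True
    have 0: "v a g = \<zero>" if "a \<in> A" "k \<le> g" for a g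
      using Suc.prems(2)[of a g] that True by (cases "g = k") auto
    have "\<exists>S\<subseteq>A. card S \<le> k \<and> (\<forall>c\<in>A. v c \<in> lin_span (v ` {a \<in> S. a = c \<or> w a < w c}))"
      by (rule Suc.IH[OF Suc.prems(1)]) (rule 0)
    then show ?thesis by (meson le_SucI)
  next
    case False
    define Z where "Z = {a \<in> A. v a k \<noteq> \<zero>}"
    have Z: "finite Z" "Z \<noteq> {}" using assms(1) False by (auto simp: Z_def)
    define b where "b = arg_min_on w Z"
    have b: "b \<in> Z" using arg_min_if_finite(1)[OF Z] by (simp add: b_def)
    have b_min: "w b \<le> w a" if "a \<in> Z" for a
      using arg_min_least[OF Z that] by (simp add: b_def)
    have bA: "b \<in> A" using b by (simp add: Z_def)
    have bk: "v b k \<in> Units R" using b V[OF bA] by (simp add: Z_def field_Units)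
    \<comment> \<open>Adding \<open>q a\<close> times \<open>v b\<close> clears coordinate
      \<open>k\<close> of \<open>v a\<close>. For \<open>a = b\<close> nothing is left, so
      \<open>b\<close> itself has to join the basis.\<close>
    define q where "q = (\<lambda>a. \<ominus> (v a k \<otimes> inv (v b k)))"
    have q: "q a \<in> carrier R" if "a \<in> A" for a using V[OF that] bk by (simp add: q_def)
    have q0: "q a = \<zero>" if "a \<in> A" "a \<notin> Z" for a
      using that bk by (simp add: q_def Z_def)
    define v' where "v' = (\<lambda>a g. v a g \<oplus> q a \<otimes> v b g)"
    have V': "v' ` A \<subseteq> UNIV \<rightarrow> carrier R"
      using V V[OF bA] q by (auto simp: v'_def)
    have 0: "v' a g = \<zero>" if a: "a \<in> A" and g: "k \<le> g" for a g
    proof (cases "g = k")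
      case True
      have "v' a k = v a k \<oplus> \<ominus> (v a k \<otimes> (inv (v b k) \<otimes> v b k))"
        using V[OF a] V[OF bA] bk by (simp add: v'_def q_def l_minus m_assoc)
      then show ?thesis using V[OF a] bk True by (simp add: r_neg)
    next
      case False
      then have "Suc k \<le> g" using g by simp
      then have "v a g = \<zero>" "v b g = \<zero>" using Suc.prems(2) a bA by blast+
      then show ?thesis using q[OF a] by (simp add: v'_def)
    qed
    have "\<exists>S\<subseteq>A. card S \<le> k \<and> (\<forall>c\<in>A. v' c \<in> lin_span (v' ` {a \<in> S. a = c \<or> w a < w c}))"
      by (rule Suc.IH[OF V']) (rule 0)
    then obtain S where S: "S \<subseteq> A" "card S \<le> k"
      and span: "\<And>c. c \<in> A \<Longrightarrow> v' c \<in> lin_span (v' ` {a \<in> S. a = c \<or> w a < w c})" by blast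
    have V_eq: "v a = (\<lambda>g. v' a g \<oplus> \<ominus> q a \<otimes> v b g)" if "a \<in> A" for a
      using V[OF that] V[OF bA] q[OF that] by (auto simp: v'_def a_assoc l_minus r_neg)
    have "v c \<in> lin_span (v ` {a \<in> insert b S. a = c \<or> w a < w c})" (is "_ \<in> lin_span ?W")
      if c: "c \<in> A" for c
    proof -
      have W: "?W \<subseteq> UNIV \<rightarrow> carrier R" using V S(1) bA by auto
      \<comment> \<open>Only vectors in \<open>Z\<close> involve the pivot, and the pivot is the
        lightest of them. Injectivity of the weight turns \<open>w b \<le> w c\<close> into
        \<open>b = c\<close> or strictly lighter.\<close>
      have bW: "v b \<in> ?W" if "a \<in> Z" "a = c \<or> w a < w c" for a
      proof -
        have "w b \<le> w c" using b_min[OF that(1)] that(2) by auto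
        then have "b = c \<or> w b < w c" using assms(2) bA c by (auto simp: inj_on_def le_less)
        then show ?thesis by blast
      qed
      \<comment> \<open>Used in both directions: with \<open>x = q a\<close> to reach
        \<open>v' a\<close> from \<open>v a\<close>, and with the opposite sign to return from
        \<open>v' c\<close> to \<open>v c\<close>.\<close>
      have qb: "(\<lambda>g. u g \<oplus> x \<otimes> v b g) \<in> lin_span ?W"
        if u: "u \<in> lin_span ?W" and a: "a \<in> A" "a = c \<or> w a < w c"
          and x: "x \<in> carrier R" "a \<notin> Z \<Longrightarrow> x = \<zero>" for u a x
      proof (cases "a \<in> Z")
        case True
        show ?thesis by (rule lin_span.add[OF u bW[OF True a(2)] x(1)])
      next
        case False
        then show ?thesis using x(2) u lin_span_closed[OF u W] V[OF bA] by simp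
      qed
      have "v' a \<in> lin_span ?W" if a: "a \<in> S" "a = c \<or> w a < w c" for a
      proof -
        have "v a \<in> ?W" using a by blast
        then have "v a \<in> lin_span ?W" using W by (rule lin_span_base)
        moreover have "a \<in> A" using a S by blast
        ultimately show ?thesis unfolding v'_def by (rule qb) (use a q q0 \<open>a \<in> A\<close> in auto)
      qed
      then have v'c: "v' c \<in> lin_span ?W"
        by (intro lin_span_subset[OF span[OF c] _ W]) blast
      have "(\<lambda>g. v' c g \<oplus> \<ominus> q c \<otimes> v b g) \<in> lin_span ?W"
        by (rule qb[OF v'c c]) (use c q q0 in auto)
      then show ?thesis using V_eq[OF c] by simp
    qed
    moreover have "card (insert b S) \<le> Suc k"
      using S(2) card_insert_le_m1[of "Suc k" S b] by simp
    moreover have "insert b S \<subseteq> A" using S(1) bA by blast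
    ultimately show ?thesis by meson
  qed
qed

section \<open>Coefficient vectors of the gates of a circuit\<close>

lemma gate_values_snoc: "gate_values \<phi> (gs @ [g]) = gate_values \<phi> gs @ [\<phi> (gate_values \<phi> gs) g]"
  by (simp add: gate_values_def)

lemma length_gate_values [simp]: "length (gate_values \<phi> gs) = length gs"
  by (induction gs rule: rev_induct) (auto simp: gate_values_snoc gate_values_def[of _ "[]"])

lemma gate_values_nth:
  "i < length gs \<Longrightarrow> gate_values \<phi> gs ! i = \<phi> (take i (gate_values \<phi> gs)) (gs ! i)"
proof (induction gs rule: rev_induct)
  case (snoc g gs)
  then show ?case by (cases "i = length gs") (auto simp: gate_values_snoc nth_append)
qed simp

lemma finite_bounded_multisets:
  assumes "finite I"
  shows "finite {m. set_mset m \<subseteq> I \<and> size m \<le> k}"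
proof (rule finite_subset)
  show "{m. set_mset m \<subseteq> I \<and> size m \<le> k} \<subseteq> (\<Union>j\<le>k. multisets_of_size I j)"
    by (auto simp: multisets_of_size_def)
qed (use assms in auto)

lemma finite_submultisets: "finite {a. a \<subseteq># m}"
  by (rule finite_subset[OF _ finite_bounded_multisets[of "set_mset m" "size m"]])
    (auto dest: mset_subset_eqD size_mset_mono)

fun join_trees :: "reduced_tree option \<Rightarrow> reduced_tree option \<Rightarrow> reduced_tree option" where
  "join_trees None r = r"
| "join_trees (Some a) None = Some a"
| "join_trees (Some a) (Some b) = Some (RNode a b)"

lemma reduce_Prod_Node: "reduce gs (Prod_Node g t u) = join_trees (reduce gs t) (reduce gs u)"
  by (auto split: option.splits)

lemma generated_monom_simps [simp]:
  "generated_monom None = {#}" "generated_monom (Some x) = tree_monom x"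
  "generated_monom (join_trees r r') = generated_monom r + generated_monom r'"
  by (auto simp: generated_monom_def split: option.splits)

lemma tree_monom_nonempty [simp]: "tree_monom x \<noteq> {#}"
  by (induction x) auto

fun rheight :: "reduced_tree \<Rightarrow> nat" where
  "rheight (RLeaf i) = 0"
| "rheight (RNode x y) = Suc (max (rheight x) (rheight y))"

lemma same_tree_monom: "same_tree x y \<Longrightarrow> tree_monom x = tree_monom y"
  by (induction rule: same_tree.induct) auto

locale gate_list = field R for R :: "'a ring" (structure) +
  fixes gs :: "'a gate list" and n :: nat
  assumes gate_ok: "\<And>i. i < length gs \<Longrightarrow> (case gs ! i of
        Var j \<Rightarrow> j < n
      | Const a \<Rightarrow> a \<in> carrier R
      | Plus js \<Rightarrow> js \<noteq> [] \<and> (\<forall>j\<in>set js. j < i)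
      | Times j k \<Rightarrow> j < i \<and> k < i)"
begin

lemma gate_cases [consumes 1, case_names Var Const Plus Times]:
  assumes "g < length gs"
  obtains (Var) i where "gs ! g = Var i" "i < n"
  | (Const) a where "gs ! g = Const a" "a \<in> carrier R"
  | (Plus) js where "gs ! g = Plus js" "js \<noteq> []" "\<And>j. j \<in> set js \<Longrightarrow> j < g"
  | (Times) j k where "gs ! g = Times j k" "j < g" "k < g"
  using gate_ok[OF assms] by (cases "gs ! g") auto

lemma gate_induct [consumes 1, case_names Var Const Plus Times]:
  assumes "g < length gs"
    and "\<And>g i. g < length gs \<Longrightarrow> gs ! g = Var i \<Longrightarrow> i < n \<Longrightarrow> P g"
    and "\<And>g a. g < length gs \<Longrightarrow> gs ! g = Const a \<Longrightarrow> a \<in> carrier R \<Longrightarrow> P g"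
    and "\<And>g js. g < length gs \<Longrightarrow> gs ! g = Plus js \<Longrightarrow> js \<noteq> [] \<Longrightarrow>
      (\<And>j. j \<in> set js \<Longrightarrow> j < g \<and> j < length gs \<and> P j) \<Longrightarrow> P g"
    and "\<And>g j k. g < length gs \<Longrightarrow> gs ! g = Times j k \<Longrightarrow> j < g \<Longrightarrow> k < g \<Longrightarrow> j < length gs \<Longrightarrow>
      k < length gs \<Longrightarrow> P j \<Longrightarrow> P k \<Longrightarrow> P g"
  shows "P g"
  using assms(1)
proof (induction g rule: less_induct)
  case (less g)
  from less.prems show ?case
  proof (cases rule: gate_cases)
    case (Plus js)
    have "j < g \<and> j < length gs \<and> P j" if "j \<in> set js" for j
      using Plus(3)[OF that] less.IH[of j] less.prems by auto
    then show ?thesis using assms(4)[OF less.prems Plus(1,2)] by blast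
  next
    case (Times j k)
    then show ?thesis using assms(5)[OF less.prems Times] less.IH[of j] less.IH[of k] less.prems by auto
  qed (use less.prems assms(2,3) in blast)+
qed

text \<open>Over a list, since a sum gate may name the same child several times.\<close>

definition gsum :: "(nat \<Rightarrow> 'a) \<Rightarrow> nat list \<Rightarrow> 'a" where
  "gsum y js = foldr (\<lambda>j x. y j \<oplus> x) js \<zero>"

lemma gsum_simps [simp]: "gsum y [] = \<zero>" "gsum y (j # js) = y j \<oplus> gsum y js"
  by (auto simp: gsum_def)

lemma gsum_closed [simp]: "(\<And>j. j \<in> set js \<Longrightarrow> y j \<in> carrier R) \<Longrightarrow> gsum y js \<in> carrier R"
  by (induction js) auto

lemma gsum_cong: "(\<And>j. j \<in> set js \<Longrightarrow> y j = y' j) \<Longrightarrow> gsum y js = gsum y' js"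
  by (induction js) auto

lemma gsum_zero: "(\<And>j. j \<in> set js \<Longrightarrow> y j = \<zero>) \<Longrightarrow> gsum y js = \<zero>"
  by (induction js) auto

lemma gsum_add:
  "(\<And>j. j \<in> set js \<Longrightarrow> y j \<in> carrier R) \<Longrightarrow> (\<And>j. j \<in> set js \<Longrightarrow> z j \<in> carrier R) \<Longrightarrow>
    gsum (\<lambda>j. y j \<oplus> z j) js = gsum y js \<oplus> gsum z js"
  by (induction js) (auto simp: a_ac)

lemma gsum_smult:
  "c \<in> carrier R \<Longrightarrow> (\<And>j. j \<in> set js \<Longrightarrow> y j \<in> carrier R) \<Longrightarrow> gsum (\<lambda>j. c \<otimes> y j) js = c \<otimes> gsum y js"
  by (induction js) (auto simp: r_distr)

section \<open>Coefficients of the gate polynomials\<close>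

definition cf :: "nat \<Rightarrow> 'a mpoly" where
  "cf g = gate_values (gate_poly R) gs ! g"

lemma cf_Var: "g < length gs \<Longrightarrow> gs ! g = Var i \<Longrightarrow> cf g m = (if m = {#i#} then \<one> else \<zero>)"
  unfolding cf_def by (subst gate_values_nth)
    (auto simp: indexed_var_def indexed_pmult_def indexed_const_def dest: multi_member_split)

lemma cf_Const: "g < length gs \<Longrightarrow> gs ! g = Const a \<Longrightarrow> cf g m = (if m = {#} then a else \<zero>)"
  unfolding cf_def by (subst gate_values_nth) (auto simp: indexed_const_def)

lemma cf_Plus:
  assumes "g < length gs" "gs ! g = Plus js"
  shows "cf g m = gsum (\<lambda>j. cf j m) js"
proof -
  have "foldr (indexed_padd) (map ((!) vs) js) (indexed_const \<zero>) m = gsum (\<lambda>j. (vs ! j) m) js" for vs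
    by (induction js) (auto simp: indexed_padd_def indexed_const_def)
  then have "cf g m = gsum (\<lambda>j. (take g (gate_values (gate_poly R) gs) ! j) m) js"
    using assms by (simp add: cf_def gate_values_nth)
  also have "\<dots> = gsum (\<lambda>j. cf j m) js"
    using assms gate_ok[OF assms(1)] by (intro gsum_cong) (auto simp: cf_def)
  finally show ?thesis .
qed

lemma cf_Times:
  assumes "g < length gs" "gs ! g = Times j k"
  shows "cf g m = (\<Oplus>a\<in>{a. a \<subseteq># m}. cf j a \<otimes> cf k (m - a))"
  using assms gate_ok[OF assms(1)] by (simp add: cf_def gate_values_nth mpoly_mult_def)

lemma cf_closed [simp]: "g < length gs \<Longrightarrow> cf g m \<in> carrier R"
proof (induction arbitrary: m rule: gate_induct)
  case (Times g j k)
  then show ?case by (auto simp: cf_Times)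
qed (auto simp: cf_Var cf_Const cf_Plus)

section \<open>Reduced trees generated at a gate\<close>

definition gen :: "nat \<Rightarrow> reduced_tree option \<Rightarrow> bool" where
  "gen g r \<longleftrightarrow> g < length gs \<and> (\<exists>t. is_parse_tree gs g t \<and> reduce gs t = r)"

lemma gen_Var: "g < length gs \<Longrightarrow> gs ! g = Var i \<Longrightarrow> gen g (Some (RLeaf i))"
  using is_parse_tree.var[of g gs i] by (fastforce simp: gen_def)

lemma gen_Const: "g < length gs \<Longrightarrow> gs ! g = Const a \<Longrightarrow> gen g None"
  using is_parse_tree.const[of g gs a] by (fastforce simp: gen_def)

lemma gen_Plus: "g < length gs \<Longrightarrow> gs ! g = Plus js \<Longrightarrow> j \<in> set js \<Longrightarrow> gen j r \<Longrightarrow> gen g r"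
  using is_parse_tree.plus[of g gs js j] by (fastforce simp: gen_def)

lemma gen_Times:
  "g < length gs \<Longrightarrow> gs ! g = Times j k \<Longrightarrow> gen j r \<Longrightarrow> gen k r' \<Longrightarrow> gen g (join_trees r r')"
  using is_parse_tree.times[of g gs j k] unfolding gen_def by (metis reduce_Prod_Node)

lemma gen_induct [consumes 1, case_names Var Const Plus Times]:
  assumes "gen g r"
    and "\<And>g i. g < length gs \<Longrightarrow> gs ! g = Var i \<Longrightarrow> P g (Some (RLeaf i))"
    and "\<And>g a. g < length gs \<Longrightarrow> gs ! g = Const a \<Longrightarrow> P g None"
    and "\<And>g js j r. g < length gs \<Longrightarrow> gs ! g = Plus js \<Longrightarrow> j \<in> set js \<Longrightarrow> gen j r \<Longrightarrow> P j r \<Longrightarrow> P g r"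
    and "\<And>g j k r r'. g < length gs \<Longrightarrow> gs ! g = Times j k \<Longrightarrow> gen j r \<Longrightarrow> gen k r' \<Longrightarrow> P j r \<Longrightarrow>
      P k r' \<Longrightarrow> P g (join_trees r r')"
  shows "P g r"
proof -
  from assms(1) obtain t where t: "is_parse_tree gs g t" and r: "r = reduce gs t" by (auto simp: gen_def)
  have len: "g < length gs" if "is_parse_tree gs g t" for g t
    using that by cases auto
  from t have "P g (reduce gs t)"
  proof (induction rule: is_parse_tree.induct)
    case (plus g js j t)
    then show ?case using assms(4)[of g js j "reduce gs t"] len by (auto simp: gen_def)
  next
    case (times g j k t u)
    have "gen j (reduce gs t)" "gen k (reduce gs u)" using times len by (auto simp: gen_def)
    then show ?case
      using assms(5)[of g j k "reduce gs t" "reduce gs u"] times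
      unfolding reduce_Prod_Node by blast
  qed (use assms(2,3) in auto)
  then show ?thesis using r by simp
qed

text \<open>Contraction may skip gates with constant factors, so the subtrees belong to some gates
  below \<open>g\<close>, not necessarily to its children.\<close>

lemma gen_subtree:
  "gen g r \<Longrightarrow> r = Some (RNode x y) \<Longrightarrow> (\<exists>h. gen h (Some x)) \<and> (\<exists>h. gen h (Some y))"
proof (induction arbitrary: x y rule: gen_induct)
  case (Times g j k r r')
  then show ?case by (cases r; cases r') auto
qed auto

lemma gen_vars: "gen g r \<Longrightarrow> set_mset (generated_monom r) \<subseteq> {..<n}"
proof (induction rule: gen_induct)
  case (Var g i)
  then show ?case using gate_ok[of g] by simp
qed auto

text \<open>Reduction only removes product nodes, so it cannot increase the height.\<close>

lemma gen_depth:
  "gen g r \<Longrightarrow> r = Some x \<Longrightarrow> rheight x \<le> gate_values gate_depth gs ! g"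
proof (induction arbitrary: x rule: gen_induct)
  case (Plus g js j r)
  have "j < g" using gate_ok[OF Plus(1)] Plus by auto
  then have "gate_values gate_depth gs ! j \<in> (!) (take g (gate_values gate_depth gs)) ` set js"
    using Plus(3) by force
  then have "gate_values gate_depth gs ! j \<le> gate_values gate_depth gs ! g"
    using Plus by (subst gate_values_nth[of g]) auto
  then show ?case using Plus by force
next
  case (Times g j k r r')
  have "j < g" "k < g" using gate_ok[OF Times(1)] Times by auto
  then have "gate_values gate_depth gs ! g
      = Suc (max (gate_values gate_depth gs ! j) (gate_values gate_depth gs ! k))"
    using Times by (subst gate_values_nth) auto
  then show ?case
    using Times(5,6,7) by (cases r; cases r') (auto simp: max_def le_Suc_eq intro: le_trans)
qed auto

text \<open>Only this direction holds in general: contributions of different parse trees to one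
  monomial may cancel.\<close>

lemma cf_nonzeroD: "g < length gs \<Longrightarrow> cf g m \<noteq> \<zero> \<Longrightarrow> \<exists>r. gen g r \<and> generated_monom r = m"
proof (induction arbitrary: m rule: gate_induct)
  case (Var g i)
  then show ?case
    by (intro exI[of _ "Some (RLeaf i)"]) (auto simp: cf_Var gen_Var split: if_splits)
next
  case (Const g a)
  then show ?case by (intro exI[of _ None]) (auto simp: cf_Const gen_Const split: if_splits)
next
  case (Plus g js)
  then obtain j where j: "j \<in> set js" "cf j m \<noteq> \<zero>"
    using gsum_zero[of js "\<lambda>j. cf j m"] by (auto simp: cf_Plus)
  then show ?case using Plus gen_Plus by blast
next
  case (Times g j k)
  have "\<exists>a. a \<subseteq># m \<and> cf j a \<otimes> cf k (m - a) \<noteq> \<zero>"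
  proof (rule ccontr)
    assume "\<not> ?thesis"
    then have "cf g m = (\<Oplus>a\<in>{a. a \<subseteq># m}. \<zero>)"
      unfolding cf_Times[OF Times(1,2)] by (intro finsum_cong') auto
    then show False using Times by simp
  qed
  then obtain a where a: "a \<subseteq># m" "cf j a \<noteq> \<zero>" "cf k (m - a) \<noteq> \<zero>"
    using Times(5,6) by (auto simp: integral_iff)
  obtain r r' where "gen j r" "generated_monom r = a" "gen k r'" "generated_monom r' = m - a"
    using Times(7)[OF a(2)] Times(8)[OF a(3)] by blast
  then show ?case using gen_Times[OF Times(1,2)] a(1) by (intro exI[of _ "join_trees r r'"]) auto
qed

lemma cf_finite_support:
  assumes "g < length gs" "mpoly_degree_le R (cf g) d"
  shows "finite {m. cf g m \<noteq> \<zero>}"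
proof (rule finite_subset[OF _ finite_bounded_multisets[of "{..<n}" d]])
  show "{m. cf g m \<noteq> \<zero>} \<subseteq> {m. set_mset m \<subseteq> {..<n} \<and> size m \<le> d}"
    using cf_nonzeroD[OF assms(1)] gen_vars assms(2) by (fastforce simp: mpoly_degree_le_def)
qed simp

text \<open>An ordered pair, in the order of the children; unambiguity determines it only up to
  exchange.\<close>

definition splits :: "nat multiset \<Rightarrow> nat multiset \<Rightarrow> bool" where
  "splits a b \<longleftrightarrow> (\<exists>g x y. gen g (Some (RNode x y)) \<and> tree_monom x = a \<and> tree_monom y = b)"

text \<open>With the strict inequality level 0 is empty and starts the induction trivially; product
  depth \<open>\<Delta>\<close> then corresponds to level \<open>\<Delta> + 1\<close>. The constant
  monomial, which has no tree, is in no level.\<close>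

definition level :: "nat \<Rightarrow> nat multiset set" where
  "level k = {m. \<exists>g x. gen g (Some x) \<and> tree_monom x = m \<and> rheight x < k}"

lemma level_SucD:
  assumes "m \<in> level (Suc k)"
  shows "(\<exists>i<n. m = {#i#}) \<or> (\<exists>a b. m = a + b \<and> splits a b \<and> a \<in> level k \<and> b \<in> level k)"
proof -
  from assms obtain g x where x: "gen g (Some x)" "tree_monom x = m" "rheight x < Suc k"
    by (auto simp: level_def)
  show ?thesis
  proof (cases x)
    case (RLeaf i)
    then show ?thesis using gen_vars[OF x(1)] x by auto
  next
    case (RNode y z)
    then have "tree_monom y \<in> level k" "tree_monom z \<in> level k" "splits (tree_monom y) (tree_monom z)"
      using gen_subtree[OF x(1), of y z] x by (auto simp: level_def splits_def)
    then show ?thesis using x(2) RNode by auto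
  qed
qed

lemma cf_Times_splits:
  assumes "g < length gs" "gs ! g = Times j k" "j < length gs" "k < length gs"
    and "cf j a \<noteq> \<zero>" "cf k b \<noteq> \<zero>" "a \<noteq> {#}" "b \<noteq> {#}"
  shows "splits a b"
proof -
  obtain r r' where r: "gen j r" "generated_monom r = a" "gen k r'" "generated_monom r' = b"
    using cf_nonzeroD[OF assms(3,5)] cf_nonzeroD[OF assms(4,6)] by blast
  then obtain x y where "r = Some x" "r' = Some y" using assms(7,8) by (cases r; cases r') auto
  then show ?thesis using gen_Times[OF assms(1,2) r(1,3)] r unfolding splits_def by auto
qed

text \<open>The extension by zero beyond the gates is what bounds the dimension by
  \<open>length gs\<close> in \<open>exists_weight_basis\<close>.\<close>

definition mvec :: "nat multiset \<Rightarrow> nat \<Rightarrow> 'a" where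
  "mvec m g = (if g < length gs then cf g m else \<zero>)"

lemma mvec_closed [simp]: "mvec m g \<in> carrier R"
  by (simp add: mvec_def)

lemma mvec_Plus: "g < length gs \<Longrightarrow> gs ! g = Plus js \<Longrightarrow> mvec m g = gsum (mvec m) js"
  using gate_ok[of g] by (auto simp: mvec_def cf_Plus intro!: gsum_cong)

text \<open>At a product gate either the two monomials meet here, or one child contributes its
  constant term and the other child carries the whole product. The constant terms are those of the
  circuit itself, so the value is linear in \<open>u\<close> and in \<open>v\<close>.\<close>

fun bil_gate :: "(nat \<Rightarrow> 'a) \<Rightarrow> (nat \<Rightarrow> 'a) \<Rightarrow> 'a list \<Rightarrow> 'a gate \<Rightarrow> 'a" where
  "bil_gate u v xs (Var i) = \<zero>"
| "bil_gate u v xs (Const a) = \<zero>"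
| "bil_gate u v xs (Plus js) = gsum ((!) xs) js"
| "bil_gate u v xs (Times j k) = u j \<otimes> v k \<oplus> (cf j {#} \<otimes> xs ! k \<oplus> xs ! j \<otimes> cf k {#})"

text \<open>The part of the coefficient of a product of monomials that arises when \<open>u\<close> is the coefficient
  vector of the left and \<open>v\<close> that of the right factor.\<close>

definition bil :: "(nat \<Rightarrow> 'a) \<Rightarrow> (nat \<Rightarrow> 'a) \<Rightarrow> nat \<Rightarrow> 'a" where
  "bil u v g = (if g < length gs then gate_values (bil_gate u v) gs ! g else \<zero>)"

lemma bil_Var [simp]: "gs ! g = Var i \<Longrightarrow> bil u v g = \<zero>"
  by (simp add: bil_def gate_values_nth)

lemma bil_Const [simp]: "gs ! g = Const a \<Longrightarrow> bil u v g = \<zero>"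
  by (simp add: bil_def gate_values_nth)

lemma bil_Plus:
  assumes "g < length gs" "gs ! g = Plus js"
  shows "bil u v g = gsum (bil u v) js"
proof -
  have "bil u v g = gsum ((!) (take g (gate_values (bil_gate u v) gs))) js"
    using assms by (simp add: bil_def gate_values_nth)
  also have "\<dots> = gsum (bil u v) js"
    using assms gate_ok[OF assms(1)] by (intro gsum_cong) (auto simp: bil_def)
  finally show ?thesis .
qed

lemma bil_Times:
  assumes "g < length gs" "gs ! g = Times j k"
  shows "bil u v g = u j \<otimes> v k \<oplus> (cf j {#} \<otimes> bil u v k \<oplus> bil u v j \<otimes> cf k {#})"
  using assms gate_ok[OF assms(1)] by (auto simp: bil_def gate_values_nth)

lemma bil_outside: "\<not> g < length gs \<Longrightarrow> bil u v g = \<zero>"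
  by (simp add: bil_def)

lemma bil_closed [simp]:
  assumes [simp]: "\<And>g. u g \<in> carrier R" "\<And>g. v g \<in> carrier R"
  shows "bil u v g \<in> carrier R"
proof (cases "g < length gs")
  case True
  then show ?thesis by (induction rule: gate_induct) (auto simp: bil_Plus bil_Times)
qed (simp add: bil_outside)

lemma bil_zero_left [simp]:
  assumes [simp]: "\<And>g. v g \<in> carrier R"
  shows "bil (\<lambda>_. \<zero>) v = (\<lambda>_. \<zero>)"
proof
  fix g show "bil (\<lambda>_. \<zero>) v g = \<zero>"
  proof (cases "g < length gs")
    case True
    then show ?thesis by (induction rule: gate_induct) (auto simp: bil_Plus bil_Times gsum_zero)
  qed (simp add: bil_outside)
qed

lemma bil_zero_right [simp]:
  assumes [simp]: "\<And>g. u g \<in> carrier R"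
  shows "bil u (\<lambda>_. \<zero>) = (\<lambda>_. \<zero>)"
proof
  fix g show "bil u (\<lambda>_. \<zero>) g = \<zero>"
  proof (cases "g < length gs")
    case True
    then show ?thesis by (induction rule: gate_induct) (auto simp: bil_Plus bil_Times gsum_zero)
  qed (simp add: bil_outside)
qed

lemma bil_linear_left:
  assumes [simp]: "\<And>g. u g \<in> carrier R" "\<And>g. w g \<in> carrier R" "\<And>g. v g \<in> carrier R" "c \<in> carrier R"
  shows "bil (\<lambda>g. u g \<oplus> c \<otimes> w g) v = (\<lambda>g. bil u v g \<oplus> c \<otimes> bil w v g)"
proof
  fix g
  show "bil (\<lambda>g. u g \<oplus> c \<otimes> w g) v g = bil u v g \<oplus> c \<otimes> bil w v g"
  proof (cases "g < length gs")
    case True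
    then show ?thesis
    proof (induction rule: gate_induct)
      case (Plus g js)
      have "bil (\<lambda>g. u g \<oplus> c \<otimes> w g) v g = gsum (\<lambda>j. bil u v j \<oplus> c \<otimes> bil w v j) js"
        using Plus by (simp add: bil_Plus cong: gsum_cong)
      then show ?case using Plus by (simp add: bil_Plus gsum_add gsum_smult)
    next
      case (Times g j k)
      then show ?case
        by (simp add: bil_Times l_distr r_distr a_ac m_ac)
    qed auto
  qed (simp add: bil_outside)
qed

lemma bil_linear_right:
  assumes [simp]: "\<And>g. u g \<in> carrier R" "\<And>g. w g \<in> carrier R" "\<And>g. v g \<in> carrier R" "c \<in> carrier R"
  shows "bil v (\<lambda>g. u g \<oplus> c \<otimes> w g) = (\<lambda>g. bil v u g \<oplus> c \<otimes> bil v w g)"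
proof
  fix g
  show "bil v (\<lambda>g. u g \<oplus> c \<otimes> w g) g = bil v u g \<oplus> c \<otimes> bil v w g"
  proof (cases "g < length gs")
    case True
    then show ?thesis
    proof (induction rule: gate_induct)
      case (Plus g js)
      have "bil v (\<lambda>g. u g \<oplus> c \<otimes> w g) g = gsum (\<lambda>j. bil v u j \<oplus> c \<otimes> bil v w j) js"
        using Plus by (simp add: bil_Plus cong: gsum_cong)
      then show ?case using Plus by (simp add: bil_Plus gsum_add gsum_smult)
    next
      case (Times g j k)
      then show ?case
        by (simp add: bil_Times l_distr r_distr a_ac m_ac)
    qed auto
  qed (simp add: bil_outside)
qed

text \<open>A product gate with both coefficients nonzero would exhibit the split, so the source
  term \<open>u j \<otimes> v k\<close> vanishes at every gate.\<close>

lemma bil_not_splits: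
  assumes "\<not> splits a b" "a \<noteq> {#}" "b \<noteq> {#}"
  shows "bil (mvec a) (mvec b) = (\<lambda>_. \<zero>)"
proof
  fix g
  show "bil (mvec a) (mvec b) g = \<zero>"
  proof (cases "g < length gs")
    case True
    then show ?thesis
    proof (induction rule: gate_induct)
      case (Times g j k)
      have "cf j a = \<zero> \<or> cf k b = \<zero>"
        using cf_Times_splits[OF Times(1,2,5,6)] assms by blast
      then show ?case using Times by (auto simp: bil_Times mvec_def)
    qed (auto simp: bil_Plus gsum_zero)
  qed (simp add: bil_outside)
qed

end

section \<open>Isolating weights\<close>

lemma rel_option_same_tree_Node:
  assumes "rel_option same_tree (Some (RNode x y)) T" "rel_option same_tree (Some (RNode x' y')) T"
  shows "(tree_monom x = tree_monom x' \<and> tree_monom y = tree_monom y') \<or>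
    (tree_monom x = tree_monom y' \<and> tree_monom y = tree_monom x')"
proof -
  from assms(1) obtain z where T: "T = Some z" by (cases T) auto
  have node: "\<exists>z1 z2. z = RNode z1 z2 \<and> ((tree_monom x = tree_monom z1 \<and> tree_monom y = tree_monom z2) \<or>
      (tree_monom x = tree_monom z2 \<and> tree_monom y = tree_monom z1))"
    if "same_tree (RNode x y) z" for x y
    using that by cases (auto dest!: same_tree_monom)
  from node[of x y] node[of x' y'] assms T show ?thesis by auto
qed

text \<open>The degree is the most significant component and each round appends a less significant
  one. \<open>M\<close> has to exceed the new component of every monomial of size at most
  \<open>d\<close>.\<close>

fun wt :: "nat \<Rightarrow> nat \<Rightarrow> (nat \<Rightarrow> nat) \<Rightarrow> nat \<Rightarrow> nat \<Rightarrow> nat" where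
  "wt M B p 0 i = 1"
| "wt M B p (Suc k) i = wt M B p k i * M + B ^ i mod p k"

lemma wt_pos: "0 < M \<Longrightarrow> 0 < wt M B p k i"
  by (induction k) auto

lemma wt_cong: "(\<And>j. j < k \<Longrightarrow> p j = q j) \<Longrightarrow> wt M B p k i = wt M B q k i"
  by (induction k) auto

text \<open>The summand 2 makes the induction close: multiplied by \<open>M\<close> it pays for a
  remainder of at most \<open>M\<close> and for the next 2.\<close>

lemma wt_le:
  assumes "2 \<le> M" "\<And>j. 0 < p j" "\<And>j. p j \<le> Suc M"
  shows "wt M B p k i + 2 \<le> 3 * M ^ k"
proof (induction k)
  case (Suc k)
  have "B ^ i mod p k \<le> M" using assms(2,3)[of k] mod_less_divisor[OF assms(2), of "B ^ i" k] by linarith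
  moreover have "(wt M B p k i + 2) * M \<le> 3 * M ^ k * M" using Suc by (rule mult_right_mono) simp
  ultimately show ?case using assms(1) by (simp add: algebra_simps)
qed simp

definition monoms :: "nat \<Rightarrow> nat \<Rightarrow> nat multiset set" where
  "monoms n d = {m. m \<noteq> {#} \<and> set_mset m \<subseteq> {..<n} \<and> size m \<le> d}"

lemma wdeg_pos: "(\<And>i. 0 < w i) \<Longrightarrow> m \<noteq> {#} \<Longrightarrow> 0 < wdeg w m"
  by (cases m) (auto simp: add_pos_nonneg)

text \<open>Only the lighter monomial needs a small new component; the heavier one may have any
  degree.\<close>

lemma wdeg_less_step:
  assumes "wdeg w a < wdeg w b" "wdeg u a < M"
  shows "wdeg (\<lambda>i. w i * M + u i) a < wdeg (\<lambda>i. w i * M + u i) b"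
proof -
  have "wdeg w a * M + wdeg u a < Suc (wdeg w a) * M" using assms(2) by simp
  also have "\<dots> \<le> wdeg w b * M" using assms(1) by (intro mult_right_mono) auto
  finally show ?thesis by (simp add: wdeg_affine)
qed

lemma wdeg_mod_less:
  assumes "0 < p" "p \<le> Q" "Q * d < M" "size m \<le> d"
  shows "wdeg (\<lambda>i. B i mod p) m < M"
proof -
  have "wdeg (\<lambda>i. B i mod p) m \<le> p * size m"
    using assms(1) by (intro wdeg_le) (simp add: less_imp_le)
  also have "\<dots> \<le> Q * d" using assms by (intro mult_mono) auto
  finally show ?thesis using assms(3) by simp
qed

text \<open>This keeps all replacements within degree \<open>d\<close>: whatever has larger degree
  is heavier, in every round.\<close>

lemma wt_size_mono:
  assumes "\<And>j. p j \<in> {2..Q}" "Q * d < M" "size a \<le> d" "size a < size b"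
  shows "wdeg (wt M B p k) a < wdeg (wt M B p k) b"
proof (induction k)
  case (Suc k)
  have "wdeg (\<lambda>i. B ^ i mod p k) a < M"
    using assms by (intro wdeg_mod_less[of _ Q d]) (auto intro: less_le_trans[of 0 2])
  from wdeg_less_step[OF Suc this] show ?case by simp
qed (use assms(4) in simp)

locale unambiguous_gate_list = gate_list +
  assumes unamb: "\<exists>T. \<forall>g r. gen g r \<and> generated_monom r = m \<longrightarrow> rel_option same_tree r T"
begin

section \<open>Coefficient vectors in an unambiguous circuit\<close>

lemma splits_unique:
  assumes "splits a b" "splits a' b'" "a + b = a' + b'"
  shows "(a = a' \<and> b = b') \<or> (a = b' \<and> b = a')"
proof -
  obtain g x y where x: "gen g (Some (RNode x y))" "tree_monom x = a" "tree_monom y = b"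
    using assms(1) by (auto simp: splits_def)
  obtain g' x' y' where y: "gen g' (Some (RNode x' y'))" "tree_monom x' = a'" "tree_monom y' = b'"
    using assms(2) by (auto simp: splits_def)
  obtain T where T: "\<And>g r. gen g r \<Longrightarrow> generated_monom r = a + b \<Longrightarrow> rel_option same_tree r T"
    using unamb[of "a + b"] by blast
  have "rel_option same_tree (Some (RNode x y)) T" "rel_option same_tree (Some (RNode x' y')) T"
    using T[OF x(1)] T[OF y(1)] x y assms(3) by auto
  from rel_option_same_tree_Node[OF this] show ?thesis using x y by auto
qed

lemma splits_nonempty: "splits a b \<Longrightarrow> a \<noteq> {#} \<and> b \<noteq> {#}"
  by (auto simp: splits_def)

text \<open>Any other submonomial with a nonzero term would give a second split of
  \<open>a + b\<close>. The index is a set, so for \<open>a = b\<close> the middle term is counted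
  once.\<close>

lemma cf_Times_unique:
  assumes "splits a b" and g: "g < length gs" "gs ! g = Times j k" "j < length gs" "k < length gs"
  shows "cf g (a + b) = (\<Oplus>x\<in>{{#}, a + b, a, b}. cf j x \<otimes> cf k (a + b - x))"
proof -
  have "cf j x \<otimes> cf k (a + b - x) = \<zero>"
    if "x \<subseteq># a + b" "x \<notin> {{#}, a + b, a, b}" for x
  proof (rule ccontr)
    assume "cf j x \<otimes> cf k (a + b - x) \<noteq> \<zero>"
    then have "cf j x \<noteq> \<zero>" "cf k (a + b - x) \<noteq> \<zero>" using g by (auto simp: integral_iff)
    moreover have "x \<noteq> {#}" "a + b - x \<noteq> {#}"
      using that by (auto simp: Diff_eq_empty_iff_mset subset_mset.antisym)
    ultimately have "splits x (a + b - x)" using cf_Times_splits[OF g] by blast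
    from splits_unique[OF this assms(1)] that show False by auto
  qed
  then show ?thesis
    unfolding cf_Times[OF g(1,2)] using finite_submultisets g
    by (intro add.finprod_mono_neutral_cong_right) auto
qed

lemma mvec_splits:
  assumes "splits a b" "a \<noteq> b"
  shows "mvec (a + b) = (\<lambda>g. bil (mvec a) (mvec b) g \<oplus> bil (mvec b) (mvec a) g)"
proof
  fix g
  have ne: "a \<noteq> {#}" "b \<noteq> {#}" using splits_nonempty[OF assms(1)] by auto
  show "mvec (a + b) g = bil (mvec a) (mvec b) g \<oplus> bil (mvec b) (mvec a) g"
  proof (cases "g < length gs")
    case True
    then show ?thesis
    proof (induction rule: gate_induct)
      case (Var g i)
      have "a + b \<noteq> {#i#}" using ne by (auto simp: union_is_single)
      then show ?case using Var by (simp add: mvec_def cf_Var)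
    next
      case (Const g c)
      then show ?case using ne by (simp add: mvec_def cf_Const)
    next
      case (Plus g js)
      have "mvec (a + b) g = gsum (\<lambda>j. bil (mvec a) (mvec b) j \<oplus> bil (mvec b) (mvec a) j) js"
        using Plus by (simp add: mvec_Plus cong: gsum_cong)
      then show ?case using Plus by (simp add: bil_Plus gsum_add)
    next
      case (Times g j k)
      have "cf g (a + b) = cf j {#} \<otimes> cf k (a + b) \<oplus> (cf j (a + b) \<otimes> cf k {#} \<oplus>
          (cf j a \<otimes> cf k b \<oplus> cf j b \<otimes> cf k a))"
        using Times ne assms(2) by (simp add: cf_Times_unique[OF assms(1) Times(1,2)])
      then show ?case
        using Times by (simp add: bil_Times mvec_def l_distr r_distr a_ac)
    qed
  qed (simp add: bil_outside mvec_def)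
qed

text \<open>For equal halves the two orders are the same term, and the symmetrised form would be
  twice the coefficient.\<close>

lemma mvec_splits_double:
  assumes "splits a a"
  shows "mvec (a + a) = bil (mvec a) (mvec a)"
proof
  fix g
  have ne: "a \<noteq> {#}" using splits_nonempty[OF assms(1)] by auto
  show "mvec (a + a) g = bil (mvec a) (mvec a) g"
  proof (cases "g < length gs")
    case True
    then show ?thesis
    proof (induction rule: gate_induct)
      case (Var g i)
      have "a + a \<noteq> {#i#}" using ne by (auto simp: union_is_single)
      then show ?case using Var by (simp add: mvec_def cf_Var)
    next
      case (Const g c)
      then show ?case using ne by (simp add: mvec_def cf_Const)
    next
      case (Plus g js)
      then show ?case by (simp add: mvec_Plus bil_Plus cong: gsum_cong)
    next
      case (Times g j k)
      have "cf g (a + a) = cf j {#} \<otimes> cf k (a + a) \<oplus> (cf j (a + a) \<otimes> cf k {#} \<oplus> cf j a \<otimes> cf k a)"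
        using Times ne by (simp add: cf_Times_unique[OF assms Times(1,2)])
      then show ?case
        using Times by (simp add: bil_Times mvec_def a_ac)
    qed
  qed (simp add: bil_outside mvec_def)
qed

lemma mvec_image_closed: "mvec ` A \<subseteq> UNIV \<rightarrow> carrier R"
  by auto

section \<open>Propagation of linear dependencies\<close>

definition sbil :: "(nat \<Rightarrow> 'a) \<Rightarrow> (nat \<Rightarrow> 'a) \<Rightarrow> nat \<Rightarrow> 'a" where
  "sbil u v g = bil u v g \<oplus> bil v u g"

lemma bil_diag_base:
  assumes "a \<noteq> {#}" "a + a \<in> W"
  shows "bil (mvec a) (mvec a) \<in> lin_span (mvec ` W)"
proof (cases "splits a a")
  case True
  then show ?thesis
    using lin_span_base[OF imageI[OF assms(2)] mvec_image_closed] mvec_splits_double by simp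
next
  case False
  then show ?thesis using bil_not_splits[of a a] assms lin_span.zero by simp
qed

text \<open>Either some order splits and the form is a multiple of the vector of
  \<open>a + b\<close>, or neither does and the form is zero. In both cases it depends on the
  circuit only through \<open>a + b\<close>, although the split itself is unknown.\<close>

lemma sbil_base:
  assumes "a \<noteq> {#}" "b \<noteq> {#}" "a + b \<in> W"
  shows "sbil (mvec a) (mvec b) \<in> lin_span (mvec ` W)"
proof -
  consider "a = b" | "a \<noteq> b" "splits a b" | "a \<noteq> b" "splits b a" | "\<not> splits a b" "\<not> splits b a" by blast
  then show ?thesis
  proof cases
    case 1
    have "bil (mvec a) (mvec a) \<in> lin_span (mvec ` W)" using bil_diag_base[of a W] 1 assms by simp
    from lin_span_add_smult[OF this this one_closed mvec_image_closed]
    show ?thesis using 1 by (simp add: sbil_def[abs_def])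
  next
    case 2
    then show ?thesis
      using lin_span_base[OF imageI[OF assms(3)] mvec_image_closed] mvec_splits[of a b]
      by (simp add: sbil_def[abs_def])
  next
    case 3
    then have "mvec (a + b) = sbil (mvec a) (mvec b)"
      using mvec_splits[of b a] by (auto simp: sbil_def a_comm add.commute)
    then show ?thesis
      using lin_span_base[OF imageI[OF assms(3)] mvec_image_closed] by metis
  next
    case 4
    then show ?thesis using bil_not_splits[of a b] bil_not_splits[of b a] assms lin_span.zero
      by (simp add: sbil_def[abs_def])
  qed
qed

lemma sbil_span_right:
  assumes "v \<in> lin_span (mvec ` W)" and u: "\<And>g. u g \<in> carrier R"
    and "\<And>b. b \<in> W \<Longrightarrow> sbil u (mvec b) \<in> lin_span (mvec ` W')"
  shows "sbil u v \<in> lin_span (mvec ` W')"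
  using assms(1)
proof (induction rule: lin_span.induct)
  case zero
  then show ?case using u lin_span.zero by (simp add: sbil_def[abs_def])
next
  case (add v w c)
  note [simp] = u lin_span_closed[OF add(1) mvec_image_closed] add(3)
  from add(2) obtain b where b: "b \<in> W" "w = mvec b" by blast
  have "sbil u (\<lambda>g. v g \<oplus> c \<otimes> w g) = (\<lambda>g. sbil u v g \<oplus> c \<otimes> sbil u w g)"
    by (auto simp: sbil_def b(2) bil_linear_left bil_linear_right r_distr a_ac)
  then show ?case
    using lin_span_add_smult[OF add(4) _ add(3) mvec_image_closed] assms(3)[OF b(1)] b(2) by simp
qed

lemma sbil_commute: "(\<And>g. u g \<in> carrier R) \<Longrightarrow> (\<And>g. v g \<in> carrier R) \<Longrightarrow> sbil u v = sbil v u"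
  by (auto simp: sbil_def a_comm)

lemma sbil_span:
  assumes u: "u \<in> lin_span (mvec ` W)" and v: "v \<in> lin_span (mvec ` W')"
    and W: "\<And>a b. a \<in> W \<Longrightarrow> b \<in> W' \<Longrightarrow> a \<noteq> {#} \<and> b \<noteq> {#} \<and> a + b \<in> Z"
  shows "sbil u v \<in> lin_span (mvec ` Z)"
proof -
  note uc = lin_span_closed[OF u mvec_image_closed]
  have "sbil u (mvec b) \<in> lin_span (mvec ` Z)" if "b \<in> W'" for b
  proof -
    have "sbil (mvec b) u \<in> lin_span (mvec ` Z)"
    proof (rule sbil_span_right[OF u])
      fix a assume "a \<in> W"
      then show "sbil (mvec b) (mvec a) \<in> lin_span (mvec ` Z)"
        using sbil_base[of a b Z] W[of a b] that sbil_commute[of "mvec a" "mvec b"] by simp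
    qed simp
    then show ?thesis using sbil_commute[of "mvec b" u] uc by simp
  qed
  from sbil_span_right[OF v _ this] uc show ?thesis by blast
qed

text \<open>Expanding the square of \<open>u + c w\<close> yields the squares of \<open>u\<close>
  and \<open>w\<close> and one cross term, which is symmetrised automatically; no division by 2
  occurs.\<close>

lemma bil_diag_span:
  assumes "u \<in> lin_span (mvec ` W)" and W: "\<And>a b. a \<in> W \<Longrightarrow> b \<in> W \<Longrightarrow> a \<noteq> {#} \<and> a + b \<in> Z"
  shows "bil u u \<in> lin_span (mvec ` Z)"
  using assms(1)
proof (induction rule: lin_span.induct)
  case zero
  then show ?case by (simp add: lin_span.zero)
next
  case (add u w c)
  from add(2) obtain b where b: "b \<in> W" "w = mvec b" by blast
  have w: "w \<in> lin_span (mvec ` W)" by (rule lin_span_base[OF add(2) mvec_image_closed])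
  note [simp] = lin_span_closed[OF add(1) mvec_image_closed] add(3)
  have "sbil u w \<in> lin_span (mvec ` Z)" using sbil_span[OF add(1) w] W by blast
  from lin_span_add_smult[OF add(4) this add(3) mvec_image_closed]
  have "(\<lambda>g. bil u u g \<oplus> c \<otimes> sbil u w g) \<in> lin_span (mvec ` Z)" .
  from lin_span_add_smult[OF this _ _ mvec_image_closed, of "bil w w" "c \<otimes> c"]
  have "(\<lambda>g. bil u u g \<oplus> c \<otimes> sbil u w g \<oplus> c \<otimes> c \<otimes> bil w w g) \<in> lin_span (mvec ` Z)"
    using bil_diag_base[of b Z] b W by simp
  moreover have "bil (\<lambda>g. u g \<oplus> c \<otimes> w g) (\<lambda>g. u g \<oplus> c \<otimes> w g) =
      (\<lambda>g. bil u u g \<oplus> c \<otimes> sbil u w g \<oplus> c \<otimes> c \<otimes> bil w w g)"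
    by (auto simp: b(2) bil_linear_left bil_linear_right sbil_def r_distr l_distr a_ac m_ac)
  ultimately show ?case by simp
qed

text \<open>The dependencies of both halves are multiplied out. For \<open>a = b\<close> the
  quadratic form is expanded over a single set, hence the fourth hypothesis.\<close>

lemma mvec_splits_span:
  assumes "splits a b" "mvec a \<in> lin_span (mvec ` W)" "mvec b \<in> lin_span (mvec ` W')"
    and "a = b \<Longrightarrow> W = W'"
    and "\<And>x y. x \<in> W \<Longrightarrow> y \<in> W' \<Longrightarrow> x \<noteq> {#} \<and> y \<noteq> {#} \<and> x + y \<in> Z"
  shows "mvec (a + b) \<in> lin_span (mvec ` Z)"
proof (cases "a = b")
  case True
  then show ?thesis
    using bil_diag_span[OF assms(2), of Z] mvec_splits_double[of a] assms by auto
next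
  case False
  then have "mvec (a + b) = sbil (mvec a) (mvec b)"
    using mvec_splits[OF assms(1)] by (simp add: sbil_def[abs_def])
  then show ?thesis using sbil_span[OF assms(2,3,5)] by simp
qed

text \<open>Each monomial is spanned by itself, if in \<open>S\<close>, and by strictly lighter
  elements of \<open>S\<close>. The restriction to size at most \<open>d\<close> is where refined
  weights compare lexicographically.\<close>

definition isolates :: "nat \<Rightarrow> nat \<Rightarrow> (nat \<Rightarrow> nat) \<Rightarrow> nat multiset set \<Rightarrow> bool" where
  "isolates d k w S \<longleftrightarrow> S \<subseteq> monoms n d \<and> finite S \<and> card S \<le> length gs \<and> inj_on (wdeg w) S \<and>
     (\<forall>m\<in>level k. size m \<le> d \<longrightarrow>
        mvec m \<in> lin_span (mvec ` {a \<in> S. a = m \<or> wdeg w a < wdeg w m}))"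

lemma isolates_step:
  fixes d s M :: nat
  defines "Q \<equiv> 2 * (Suc d * n * (n + s\<^sup>2)\<^sup>2)"
  assumes S: "isolates d k w S" and n: "1 \<le> n" and d: "1 \<le> d" and s: "length gs \<le> s" and M: "Q * d < M"
    and mono: "\<And>a b. size a \<le> d \<Longrightarrow> size a < size b \<Longrightarrow> wdeg w a < wdeg w b"
  shows "\<exists>p\<in>{2..Q}. \<exists>S'. isolates d (Suc k) (\<lambda>i. w i * M + Suc d ^ i mod p) S'"
proof -
  have Sm: "S \<subseteq> monoms n d" "finite S" "card S \<le> s" using S s by (auto simp: isolates_def)
  have S_span: "mvec m \<in> lin_span (mvec ` {a \<in> S. a = m \<or> wdeg w a < wdeg w m})"
    if "m \<in> level k" "size m \<le> d" for m using S that by (auto simp: isolates_def)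
  \<comment> \<open>Every monomial of the next level will be spanned by these. The cut at degree
    \<open>d\<close> allows one small modulus to separate them.\<close>
  define A where "A = (\<lambda>i. {#i#}) ` {..<n} \<union> {m \<in> (\<lambda>(a, b). a + b) ` (S \<times> S). size m \<le> d}"
  have A: "A \<subseteq> monoms n d"
    using subsetD[OF Sm(1)] d by (fastforce simp: A_def monoms_def)
  have finA: "finite A" using Sm(2) by (auto simp: A_def)
  have "card A \<le> card ((\<lambda>i. {#i#}) ` {..<n}) + card {m \<in> (\<lambda>(a, b). a + b) ` (S \<times> S). size m \<le> d}"
    unfolding A_def by (rule card_Un_le)
  also have "\<dots> \<le> n + card ((\<lambda>(a, b). a + b) ` (S \<times> S))"
    using Sm(2) card_image_le[of "{..<n}" "\<lambda>i. {#i#}"] by (intro add_mono card_mono) auto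
  also have "card ((\<lambda>(a, b). a + b) ` (S \<times> S)) \<le> card (S \<times> S)"
    using Sm(2) by (intro card_image_le) auto
  also have "\<dots> \<le> s\<^sup>2" using Sm(3) by (simp add: card_cartesian_product power2_eq_square mult_mono)
  finally have cardA: "card A \<le> n + s\<^sup>2" by simp
  have "\<exists>p\<in>{2..Q}. inj_on (wdeg (\<lambda>i. Suc d ^ i mod p)) A"
    unfolding Q_def
    by (rule exists_separating_modulus[OF finA _ cardA]) (use A n in \<open>auto simp: monoms_def\<close>)
  then obtain p where p: "p \<in> {2..Q}" "inj_on (wdeg (\<lambda>i. Suc d ^ i mod p)) A" by blast
  define w' where "w' = (\<lambda>i. w i * M + Suc d ^ i mod p)"
  have u: "wdeg (\<lambda>i. Suc d ^ i mod p) m < M" if "size m \<le> d" for m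
    using p(1) that M by (intro wdeg_mod_less[of p Q d]) auto
  have w'_less: "wdeg w' a < wdeg w' b" if "wdeg w a < wdeg w b" "size a \<le> d" for a b
    unfolding w'_def using wdeg_less_step[OF that(1) u[OF that(2)]] .
  have sizeA: "size a \<le> d" if "a \<in> A" for a using that A by (auto simp: monoms_def)
  have inj: "inj_on (wdeg w') A"
  \<comment> \<open>A tie of refined weights forces a tie of the old ones, hence also of the new
    components, which \<open>p\<close> separates.\<close>
  proof (rule inj_onI)
    fix a b assume ab: "a \<in> A" "b \<in> A" "wdeg w' a = wdeg w' b"
    then have "\<not> wdeg w a < wdeg w b" "\<not> wdeg w b < wdeg w a"
      using w'_less[of a b] w'_less[of b a] sizeA by auto
    then have "wdeg (\<lambda>i. Suc d ^ i mod p) a = wdeg (\<lambda>i. Suc d ^ i mod p) b"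
      using ab(3) by (simp add: w'_def wdeg_affine)
    then show "a = b" using p(2) ab by (auto dest: inj_onD)
  qed
  have "\<exists>S'\<subseteq>A. card S' \<le> length gs \<and>
      (\<forall>c\<in>A. mvec c \<in> lin_span (mvec ` {a \<in> S'. a = c \<or> wdeg w' a < wdeg w' c}))"
    by (rule exists_weight_basis[OF finA inj mvec_image_closed]) (simp add: mvec_def)
  then obtain S' where S': "S' \<subseteq> A" "card S' \<le> length gs"
    and span': "\<And>c. c \<in> A \<Longrightarrow> mvec c \<in> lin_span (mvec ` {a \<in> S'. a = c \<or> wdeg w' a < wdeg w' c})"
    by blast
  have "mvec m \<in> lin_span (mvec ` {a \<in> S'. a = m \<or> wdeg w' a < wdeg w' m})" (is "_ \<in> lin_span ?W")
    if m: "m \<in> level (Suc k)" "size m \<le> d" for m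
  proof -
    have "mvec m \<in> lin_span (mvec ` {c \<in> A. c = m \<or> wdeg w c < wdeg w m})"
      using level_SucD[OF m(1)]
    proof (elim disjE exE conjE)
      fix i assume i: "i < n" "m = {#i#}"
      then have "m \<in> {c \<in> A. c = m \<or> wdeg w c < wdeg w m}" by (auto simp: A_def)
      then show ?thesis by (intro lin_span_base mvec_image_closed imageI)
    next
      fix a b assume ab: "m = a + b" "splits a b" "a \<in> level k" "b \<in> level k"
      then have sz: "size a \<le> d" "size b \<le> d" using m(2) by auto
      show ?thesis
        unfolding ab(1)
      proof (rule mvec_splits_span[OF ab(2) S_span[OF ab(3) sz(1)] S_span[OF ab(4) sz(2)]])
        fix x y assume x: "x \<in> {c \<in> S. c = a \<or> wdeg w c < wdeg w a}"
          and y: "y \<in> {c \<in> S. c = b \<or> wdeg w c < wdeg w b}"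
        have xy: "x \<noteq> {#}" "y \<noteq> {#}" using x y Sm(1) by (auto simp: monoms_def)
        \<comment> \<open>An element of larger degree would be heavier by \<open>mono\<close>; so
          the sum of the replacements has degree at most that of \<open>m\<close>.\<close>
        have "size x \<le> size a" using x mono[of a x] sz by force
        moreover have "size y \<le> size b" using y mono[of b y] sz by force
        ultimately have "size (x + y) \<le> d" using m(2) ab(1) by simp
        then have "x + y \<in> A" using x y by (auto simp: A_def)
        moreover have "x + y = a + b \<or> wdeg w (x + y) < wdeg w (a + b)" using x y by auto
        ultimately show "x \<noteq> {#} \<and> y \<noteq> {#} \<and> x + y \<in> {c \<in> A. c = a + b \<or> wdeg w c < wdeg w (a + b)}"
          using xy by blast
      qed auto
    qed
    then show ?thesis
    proof (rule lin_span_subset[OF _ _ mvec_image_closed], intro subsetI, elim imageE)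
      fix v c assume v: "v = mvec c" and c: "c \<in> {c \<in> A. c = m \<or> wdeg w c < wdeg w m}"
      \<comment> \<open>Strict inequalities of the old weight survive the refinement, so what is
        lighter than \<open>c\<close> is lighter than \<open>m\<close>.\<close>
      have "{a \<in> S'. a = c \<or> wdeg w' a < wdeg w' c} \<subseteq> {a \<in> S'. a = m \<or> wdeg w' a < wdeg w' m}"
        using c w'_less[of c m] sizeA[of c] by auto
      then show "v \<in> lin_span ?W"
        unfolding v using c by (intro lin_span_mono[OF span' _ mvec_image_closed] image_mono) auto
    qed
  qed
  moreover have "inj_on (wdeg w') S'" using inj S'(1) by (rule inj_on_subset)
  ultimately have "isolates d (Suc k) w' S'"
    unfolding isolates_def using S' A finA by (auto intro: finite_subset)
  then show ?thesis using p(1) unfolding w'_def by blast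
qed

lemma exists_isolating_weight:
  fixes d s M :: nat
  defines "Q \<equiv> 2 * (Suc d * n * (n + s\<^sup>2)\<^sup>2)"
  assumes n: "1 \<le> n" and d: "1 \<le> d" and s: "length gs \<le> s" "1 \<le> s" and M: "Q * d < M"
  shows "\<exists>p S. (\<forall>j. p j \<in> {2..Q}) \<and> isolates d k (wt M (Suc d) p k) S"
proof (induction k)
  case 0
  have "1 \<le> n * (n + s\<^sup>2)\<^sup>2" using n by simp
  \<comment> \<open>The moduli form a total sequence; this makes the constant sequence 2 an
    admissible default.\<close>
  then have "2 \<le> Q" by (simp add: Q_def)
  then show ?case
    by (intro exI[of _ "\<lambda>_. 2"] exI[of _ "{}"]) (auto simp: isolates_def level_def)
next
  case (Suc k)
  then obtain p S where p: "\<And>j. p j \<in> {2..Q}" and S: "isolates d k (wt M (Suc d) p k) S" by blast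
  have "\<exists>q\<in>{2..Q}. \<exists>S'. isolates d (Suc k) (\<lambda>i. wt M (Suc d) p k i * M + Suc d ^ i mod q) S'"
    unfolding Q_def
    by (rule isolates_step[OF S n d s(1)]) (use M wt_size_mono[OF p M] in \<open>auto simp: Q_def\<close>)
  then obtain q S' where q: "q \<in> {2..Q}"
    and S': "isolates d (Suc k) (\<lambda>i. wt M (Suc d) p k i * M + Suc d ^ i mod q) S'" by blast
  \<comment> \<open>The first \<open>k\<close> rounds only read the entries below \<open>k\<close>,
    so the old weight is unaffected.\<close>
  have "wt M (Suc d) (p(k := q)) (Suc k) = (\<lambda>i. wt M (Suc d) p k i * M + Suc d ^ i mod q)"
    using wt_cong[of k "p(k := q)" p] by auto
  then have "isolates d (Suc k) (wt M (Suc d) (p(k := q)) (Suc k)) S'" using S' by simp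
  moreover have "(p(k := q)) j \<in> {2..Q}" for j using p q by simp
  ultimately show ?case by blast
qed

text \<open>Take the lightest basis monomial occurring in \<open>f\<close>. The coefficient of
  another nonconstant monomial of the same weight is a combination of coefficients of strictly
  lighter basis monomials, which all vanish.\<close>

lemma exists_isolated_monom:
  fixes d s M \<Delta> :: nat
  defines "Q \<equiv> 2 * (Suc d * n * (n + s\<^sup>2)\<^sup>2)"
  assumes nd: "1 \<le> n" "1 \<le> d" "length gs \<le> s" and M: "Q * d < M"
    and g: "g < length gs" "gate_values gate_depth gs ! g \<le> \<Delta>"
    and f: "mpoly_nonzero R (cf g)" "mpoly_degree_le R (cf g) d"
  shows "\<exists>p m. (\<forall>j. p j \<in> {2..Q}) \<and> cf g m \<noteq> \<zero> \<and>
    (\<forall>m'. cf g m' \<noteq> \<zero> \<and> wdeg (wt M (Suc d) p (Suc \<Delta>)) m' = wdeg (wt M (Suc d) p (Suc \<Delta>)) m \<longrightarrow> m' = m)"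
proof -
  have "1 \<le> s" using nd(3) g(1) by linarith
  then obtain p S where p: "\<And>j. p j \<in> {2..Q}" and S: "isolates d (Suc \<Delta>) (wt M (Suc d) p (Suc \<Delta>)) S"
    using exists_isolating_weight[of d s M "Suc \<Delta>"] nd M unfolding Q_def by blast
  define w where "w = wt M (Suc d) p (Suc \<Delta>)"
  \<comment> \<open>The constant monomial lies in no level; being the only one of weight zero, it
    collides with nothing.\<close>
  have w_pos: "0 < wdeg w m" if "m \<noteq> {#}" for m
    unfolding w_def using M that by (intro wdeg_pos wt_pos) auto
  have lev: "m \<in> level (Suc \<Delta>)" "size m \<le> d" if nz: "cf g m \<noteq> \<zero>" and ne: "m \<noteq> {#}" for m
  proof -
    obtain r where r: "gen g r" "generated_monom r = m" using cf_nonzeroD[OF g(1) nz] by blast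
    with ne obtain x where x: "r = Some x" by (cases r) auto
    then have "rheight x < Suc \<Delta>" using gen_depth[OF r(1) x] g(2) by simp
    then show "m \<in> level (Suc \<Delta>)" using r x by (auto simp: level_def)
    show "size m \<le> d" using f(2) nz by (simp add: mpoly_degree_le_def)
  qed
  have span: "mvec m \<in> lin_span (mvec ` {a \<in> S. a = m \<or> wdeg w a < wdeg w m})"
    if "cf g m \<noteq> \<zero>" "m \<noteq> {#}" for m
    using S lev[OF that] by (auto simp: isolates_def w_def)
  have Sm: "a \<noteq> {#}" if "a \<in> S" for a using S that by (auto simp: isolates_def monoms_def)
  have mvec_g: "mvec a g = cf g a" for a using g(1) by (simp add: mvec_def)
  have vanish: "cf g m = \<zero>" if "m \<noteq> {#}" "\<And>a. a \<in> S \<Longrightarrow> a = m \<or> wdeg w a < wdeg w m \<Longrightarrow> cf g a = \<zero>" for m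
    using lin_span_vanish[OF span, of m g] that mvec_g by fastforce
  define Z where "Z = {a \<in> S. cf g a \<noteq> \<zero>}"
  show ?thesis
  proof (cases "Z = {}")
    case True
    \<comment> \<open>No basis monomial occurs in \<open>f\<close>, so \<open>f\<close> is its
      constant term.\<close>
    then have z: "cf g m = \<zero>" if "m \<noteq> {#}" for m using vanish[OF that] by (auto simp: Z_def)
    obtain m where "cf g m \<noteq> \<zero>" using f(1) by (auto simp: mpoly_nonzero_def)
    then have "cf g {#} \<noteq> \<zero>" using z[of m] by (cases "m = {#}") auto
    moreover have "m = {#}" if "cf g m \<noteq> \<zero>" for m using z that by blast
    ultimately show ?thesis using p by blast
  next
    case False
    have "finite Z" using S by (simp add: Z_def isolates_def)
    define a where "a = arg_min_on (wdeg w) Z"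
    have a: "a \<in> Z" using arg_min_if_finite(1)[OF \<open>finite Z\<close> False] by (simp add: a_def)
    have a_min: "wdeg w a \<le> wdeg w b" if "b \<in> Z" for b
      using arg_min_least[OF \<open>finite Z\<close> False that] by (simp add: a_def)
    have "m = a" if m: "cf g m \<noteq> \<zero>" "wdeg w m = wdeg w a" for m
    proof (rule ccontr)
      assume "m \<noteq> a"
      have "0 < wdeg w a" using a Sm w_pos by (auto simp: Z_def)
      then have "m \<noteq> {#}" using m(2) by auto
      then have "cf g m = \<zero>"
      proof (rule vanish)
        fix b assume b: "b \<in> S" "b = m \<or> wdeg w b < wdeg w m"
        show "cf g b = \<zero>"
        proof (rule ccontr)
          assume "cf g b \<noteq> \<zero>"
          then have bZ: "b \<in> Z" using b by (simp add: Z_def)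
          \<comment> \<open>A lighter \<open>b\<close> would contradict the choice of
            \<open>a\<close>; and \<open>m\<close> in \<open>S\<close> would share its weight with
            \<open>a\<close>.\<close>
          then have "b = m" using a_min[of b] b m(2) by auto
          moreover have "inj_on (wdeg w) S" using S by (simp add: isolates_def w_def)
          ultimately show False using \<open>m \<noteq> a\<close> m(2) a b by (auto simp: Z_def dest: inj_onD)
        qed
      qed
      then show False using m(1) by simp
    qed
    then show ?thesis using a p unfolding w_def Z_def by blast
  qed
qed

end

section \<open>Evaluation on a monomial curve\<close>

context field
begin

section \<open>Univariate polynomials\<close>

definition upoly :: "nat \<Rightarrow> (nat \<Rightarrow> 'a) \<Rightarrow> 'a \<Rightarrow> 'a" where
  "upoly N c x = (\<Oplus>k\<in>{..<N}. c k \<otimes> x [^] k)"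

lemma upoly_eq_eval:
  assumes "\<And>k. c k \<in> carrier R" "x \<in> carrier R"
  shows "upoly N c x = eval (map c (rev [0..<N])) x"
proof (induction N)
  case (Suc N)
  have "upoly (Suc N) c x = c N \<otimes> x [^] N \<oplus> upoly N c x"
    unfolding upoly_def lessThan_Suc using assms by (subst finsum_insert) auto
  then show ?case using Suc by simp
qed (simp add: upoly_def)

text \<open>A nonzero polynomial of degree below \<open>N\<close> has fewer than \<open>N\<close>
  roots; here the field has to be large.\<close>

lemma upoly_not_all_zero:
  assumes c: "\<And>k. c k \<in> carrier R" and k: "k < N" "c k \<noteq> \<zero>"
    and e: "inj_on e {..<N}" "e ` {..<N} \<subseteq> carrier R"
  shows "\<exists>t<N. upoly N c (e t) \<noteq> \<zero>"
proof (rule ccontr)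
  assume "\<not> ?thesis"
  then have z: "upoly N c x = \<zero>" if "x \<in> e ` {..<N}" for x using that by auto
  \<comment> \<open>Univariate polynomials are lists starting with a nonzero leading coefficient,
    hence the reversal here and \<open>normalize\<close> below.\<close>
  define p where "p = map c (rev [0..<N])"
  have pc: "set p \<subseteq> carrier R" using c by (auto simp: p_def)
  define q where "q = normalize p"
  have q: "q \<in> carrier (poly_ring R)"
    using normalize_gives_polynomial[OF pc] by (simp add: q_def univ_poly_carrier)
  have "coeff p k = c k" using k(1) by (simp add: coeff_nth p_def rev_nth)
  then have "coeff q k \<noteq> \<zero>" using k(2) normalize_coeff[of p] by (simp add: q_def)
  then have q0: "q \<noteq> []" by auto
  have "is_root q x" if "x \<in> e ` {..<N}" for x
    using z[OF that] that e(2) upoly_eq_eval[OF c, of x N] eval_normalize[OF pc, of x] q0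
    by (auto simp: is_root_def q_def p_def)
  then have "e ` {..<N} \<subseteq> set_mset (roots q)" using roots_mem_iff_is_root[OF q] by auto
  then have "N \<le> card (set_mset (roots q))"
    using card_mono[of "set_mset (roots q)" "e ` {..<N}"] card_image[OF e(1)] by simp
  also have "\<dots> \<le> size (roots q)"
    using size_mset_mono[OF mset_set_set_mset_msubset[of "roots q"]] by simp
  also have "\<dots> \<le> degree q" by (rule size_roots_le_degree[OF q])
  also have "\<dots> < N" using normalize_length_le[of p] k(1) by (auto simp: q_def p_def)
  finally show False by simp
qed

lemma upoly_add_monom:
  assumes "\<And>k. c k \<in> carrier R" "j < N" "b \<in> carrier R" "x \<in> carrier R"
  shows "upoly N (c(j := c j \<oplus> b)) x = b \<otimes> x [^] j \<oplus> upoly N c x"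
proof -
  have "upoly N (c(j := c j \<oplus> b)) x = (\<Oplus>k\<in>{..<N}. (if j = k then b \<otimes> x [^] k else \<zero>) \<oplus> c k \<otimes> x [^] k)"
    unfolding upoly_def using assms by (intro finsum_cong') (auto simp: l_distr a_comm)
  also have "\<dots> = (\<Oplus>k\<in>{..<N}. if j = k then b \<otimes> x [^] k else \<zero>) \<oplus> upoly N c x"
    unfolding upoly_def using assms by (intro finsum_addf) auto
  also have "(\<Oplus>k\<in>{..<N}. if j = k then b \<otimes> x [^] k else \<zero>) = b \<otimes> x [^] j"
    using finsum_singleton[of j "{..<N}" "\<lambda>k. b \<otimes> x [^] k"] assms by simp
  finally show ?thesis .
qed

text \<open>Monomials of equal weight merge into one coefficient. That unattained exponents get
  coefficient zero will protect the isolated monomial.\<close>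

lemma upoly_collect:
  assumes "finite F" "\<And>m. m \<in> F \<Longrightarrow> f m \<in> carrier R" "\<And>m. m \<in> F \<Longrightarrow> w m < N"
  shows "\<exists>c. (\<forall>k. c k \<in> carrier R) \<and> (\<forall>k. k \<notin> w ` F \<longrightarrow> c k = \<zero>) \<and>
    (\<forall>x\<in>carrier R. (\<Oplus>m\<in>F. f m \<otimes> x [^] (w m :: nat)) = upoly N c x)"
  using assms
proof (induction F rule: finite_induct)
  case empty
  have "upoly N (\<lambda>_. \<zero>) x = \<zero>" if "x \<in> carrier R" for x
  proof -
    have "upoly N (\<lambda>_. \<zero>) x = (\<Oplus>k\<in>{..<N}. \<zero>)"
      unfolding upoly_def using that by (intro finsum_cong') auto
    then show ?thesis by simp
  qed
  then show ?case by (intro exI[of _ "\<lambda>_. \<zero>"]) auto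
next
  case (insert m F)
  have "\<exists>c. (\<forall>k. c k \<in> carrier R) \<and> (\<forall>k. k \<notin> w ` F \<longrightarrow> c k = \<zero>) \<and>
      (\<forall>x\<in>carrier R. (\<Oplus>m\<in>F. f m \<otimes> x [^] w m) = upoly N c x)"
    by (rule insert.IH) (use insert.prems in auto)
  then obtain c where c: "\<And>k. c k \<in> carrier R" "\<And>k. k \<notin> w ` F \<Longrightarrow> c k = \<zero>"
    "\<And>x. x \<in> carrier R \<Longrightarrow> (\<Oplus>m\<in>F. f m \<otimes> x [^] w m) = upoly N c x"
    by blast
  define c' where "c' = c(w m := c (w m) \<oplus> f m)"
  have "(\<Oplus>m\<in>insert m F. f m \<otimes> x [^] w m) = upoly N c' x"
    if "x \<in> carrier R" for x
  proof -
    have "(\<Oplus>m\<in>insert m F. f m \<otimes> x [^] w m) = f m \<otimes> x [^] w m \<oplus> (\<Oplus>m\<in>F. f m \<otimes> x [^] w m)"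
      using insert that by (intro finsum_insert) auto
    also have "\<dots> = upoly N c' x"
      unfolding c'_def using c(1,3) insert.prems that by (simp add: upoly_add_monom)
    finally show ?thesis .
  qed
  moreover have "c' k \<in> carrier R" for k using c(1) insert.prems(1) by (simp add: c'_def)
  moreover have "c' k = \<zero>" if "k \<notin> w ` insert m F" for k using c(2) that by (simp add: c'_def)
  ultimately show ?case by blast
qed

lemma finprod_powers:
  assumes "x \<in> carrier R" "finite I"
  shows "(\<Otimes>i\<in>I. x [^] (g i :: nat)) = x [^] (\<Sum>i\<in>I. g i)"
  using assms(2) by (induction rule: finite_induct) (use assms(1) in \<open>auto simp: nat_pow_mult\<close>)

end

section \<open>Substituting the curve\<close>

lemma mpoly_eval_curve:
  fixes R :: "'a ring" (structure)
  assumes "field R" and x: "x \<in> carrier R" and f: "\<And>m. f m \<in> carrier R"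
    and vars: "\<And>m. f m \<noteq> \<zero> \<Longrightarrow> set_mset m \<subseteq> {..<n}"
  shows "mpoly_eval R (map (\<lambda>i. x [^] (w i :: nat)) [0..<n]) f
    = (\<Oplus>m\<in>{m. f m \<noteq> \<zero>}. f m \<otimes> x [^] wdeg w m)"
proof -
  interpret field R by fact
  show ?thesis
    unfolding mpoly_eval_def
  proof (intro finsum_cong' refl)
    fix m assume "m \<in> {m. f m \<noteq> \<zero>}"
    then have m: "set_mset m \<subseteq> {..<n}" using vars by auto
    have "(\<Otimes>i\<in>set_mset m. map (\<lambda>i. x [^] w i) [0..<n] ! i [^] count m i)
        = (\<Otimes>i\<in>set_mset m. x [^] (count m i * w i))"
      using m x by (intro finprod_cong') (auto simp: nat_pow_pow mult.commute)
    also have "\<dots> = x [^] (\<Sum>i\<in>set_mset m. count m i * w i)"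
      using x by (intro finprod_powers) auto
    also have "(\<Sum>i\<in>set_mset m. count m i * w i) = wdeg w m"
      unfolding wdeg_conv_sum[OF m] using m by (intro sum.mono_neutral_left) (auto simp: not_in_iff)
    finally show "f m \<otimes> (\<Otimes>i\<in>set_mset m. map (\<lambda>i. x [^] w i) [0..<n] ! i [^] count m i)
        = f m \<otimes> x [^] wdeg w m" by simp
  qed (use x f in auto)
qed

lemma exists_nonzero_on_curve:
  fixes R :: "'a ring" (structure)
  assumes "field R" and f: "\<And>m. f m \<in> carrier R" "finite {m. f m \<noteq> \<zero>}"
    and vars: "\<And>m. f m \<noteq> \<zero> \<Longrightarrow> set_mset m \<subseteq> {..<n}"
    and N: "\<And>m. f m \<noteq> \<zero> \<Longrightarrow> wdeg w m < N"
    and m: "f m \<noteq> \<zero>" "\<And>m'. f m' \<noteq> \<zero> \<Longrightarrow> wdeg w m' = wdeg w m \<Longrightarrow> m' = m"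
    and e: "inj_on e {..<N}" "e ` {..<N} \<subseteq> carrier R"
  shows "\<exists>t<N. mpoly_eval R (map (\<lambda>i. e t [^] (w i :: nat)) [0..<n]) f \<noteq> \<zero>"
proof -
  interpret field R by fact
  \<comment> \<open>With the isolated monomial set aside, its power of the parameter receives
    nothing from the rest, and its coefficient is exactly \<open>f m\<close>.\<close>
  define F where "F = {m. f m \<noteq> \<zero>} - {m}"
  have F: "{m. f m \<noteq> \<zero>} = insert m F" "finite F" "m \<notin> F" using f(2) m(1) by (auto simp: F_def)
  have N': "wdeg w m < N" if "m \<in> F" for m using N that by (simp add: F_def)
  have "\<exists>c. (\<forall>k. c k \<in> carrier R) \<and> (\<forall>k. k \<notin> wdeg w ` F \<longrightarrow> c k = \<zero>) \<and>
      (\<forall>x\<in>carrier R. (\<Oplus>m\<in>F. f m \<otimes> x [^] wdeg w m) = upoly N c x)"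
    by (rule upoly_collect) (use F(2) f(1) N' in simp_all)
  then obtain c where c: "\<And>k. c k \<in> carrier R" "\<And>k. k \<notin> wdeg w ` F \<Longrightarrow> c k = \<zero>"
    and sum: "\<And>x. x \<in> carrier R \<Longrightarrow> (\<Oplus>m\<in>F. f m \<otimes> x [^] wdeg w m) = upoly N c x"
    by blast
  define c' where "c' = c(wdeg w m := c (wdeg w m) \<oplus> f m)"
  have "wdeg w m \<notin> wdeg w ` F"
  proof
    assume "wdeg w m \<in> wdeg w ` F"
    then obtain m' where "m' \<in> F" "wdeg w m' = wdeg w m" by (metis imageE)
    then show False using m(2)[of m'] by (simp add: F_def)
  qed
  then have "c' (wdeg w m) \<noteq> \<zero>" using c(2) m(1) f(1) by (simp add: c'_def)
  moreover have "c' k \<in> carrier R" for k using c(1) f(1) by (simp add: c'_def)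
  ultimately have "\<exists>t<N. upoly N c' (e t) \<noteq> \<zero>"
    using N[OF m(1)] e by (intro upoly_not_all_zero[of c' "wdeg w m"])
  then obtain t where t: "t < N" "upoly N c' (e t) \<noteq> \<zero>" by blast
  have et: "e t \<in> carrier R" using e t by auto
  have "mpoly_eval R (map (\<lambda>i. e t [^] w i) [0..<n]) f = (\<Oplus>m\<in>insert m F. f m \<otimes> e t [^] wdeg w m)"
    using mpoly_eval_curve[OF field_axioms et f(1) vars] F(1) by simp
  also have "\<dots> = f m \<otimes> e t [^] wdeg w m \<oplus> upoly N c (e t)"
    using F f(1) et sum[OF et] by simp
  also have "\<dots> = upoly N c' (e t)"
    unfolding c'_def using upoly_add_monom[of c "wdeg w m" N "f m" "e t"] c(1) f(1) et N[OF m(1)] by simp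
  finally have "mpoly_eval R (map (\<lambda>i. e t [^] w i) [0..<n]) f \<noteq> \<zero>" using t(2) by simp
  then show ?thesis using t(1) by blast
qed

section \<open>The program\<close>

definition run :: "'a ring \<Rightarrow> (nat \<Rightarrow> 'a) \<Rightarrow> cmd \<Rightarrow> 'a state \<Rightarrow> nat \<Rightarrow> 'a state \<Rightarrow> bool" where
  "run R e c \<sigma> b \<sigma>' \<longleftrightarrow> (\<exists>t\<le>b. exec R e c \<sigma> t \<sigma>')"

definition setn :: "nat \<Rightarrow> nat \<Rightarrow> 'a state \<Rightarrow> 'a state" where
  "setn k x \<sigma> = \<sigma>\<lparr>nmem := (nmem \<sigma>)(k := x)\<rparr>"

definition setf :: "'a \<Rightarrow> 'a state \<Rightarrow> 'a state" where
  "setf x \<sigma> = \<sigma>\<lparr>fmem := (fmem \<sigma>)(0 := x)\<rparr>"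

definition out :: "'a list \<Rightarrow> 'a state \<Rightarrow> 'a state" where
  "out xs \<sigma> = \<sigma>\<lparr>tape := tape \<sigma> @ xs\<rparr>"

lemma state_simps [simp]:
  "nmem (setn k x \<sigma>) = (nmem \<sigma>)(k := x)" "fmem (setn k x \<sigma>) = fmem \<sigma>" "tape (setn k x \<sigma>) = tape \<sigma>"
  "nmem (setf y \<sigma>) = nmem \<sigma>" "fmem (setf y \<sigma>) = (fmem \<sigma>)(0 := y)" "tape (setf y \<sigma>) = tape \<sigma>"
  "nmem (out ys \<sigma>) = nmem \<sigma>" "fmem (out ys \<sigma>) = fmem \<sigma>" "tape (out ys \<sigma>) = tape \<sigma> @ ys"
  by (auto simp: setn_def setf_def out_def)

lemma state_eqI:
  fixes \<sigma> \<sigma>' :: "'a state"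
  shows "(\<And>k. nmem \<sigma> k = nmem \<sigma>' k) \<Longrightarrow> (\<And>k. fmem \<sigma> k = fmem \<sigma>' k) \<Longrightarrow> tape \<sigma> = tape \<sigma>' \<Longrightarrow> \<sigma> = \<sigma>'"
  by (rule state.equality) auto

lemma run_weaken: "run R e c \<sigma> b \<sigma>' \<Longrightarrow> b \<le> b' \<Longrightarrow> \<sigma>' = \<sigma>'' \<Longrightarrow> run R e c \<sigma> b' \<sigma>''"
  unfolding run_def by (meson le_trans)

lemma run_Seq: "run R e c \<sigma> b \<sigma>' \<Longrightarrow> run R e c' \<sigma>' b' \<sigma>'' \<Longrightarrow> run R e (Seq c c') \<sigma> (b + b') \<sigma>''"
  unfolding run_def by (meson add_mono exec.Seq)

lemma run_Skip: "run R e Skip \<sigma> 1 \<sigma>"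
  unfolding run_def using exec.Skip by blast

lemma run_NAssign: "run R e (NAssign (Num k) x) \<sigma> (2 + ncost x) (setn k (nval \<sigma> x) \<sigma>)"
  unfolding run_def setn_def using exec.NAssign[of R e "Num k" x \<sigma>] by auto

lemma run_FAssign: "run R e (FAssign (Num 0) x) \<sigma> (2 + fcost x) (setf (fval R e \<sigma> x) \<sigma>)"
  unfolding run_def setf_def using exec.FAssign[of R e "Num 0" x \<sigma>] by auto

lemma run_Emit: "run R e (Emit x) \<sigma> (1 + fcost x) (out [fval R e \<sigma> x] \<sigma>)"
  unfolding run_def out_def using exec.Emit[of R e x \<sigma>] by auto

lemma run_Cond:
  assumes "bval R e \<sigma> b \<Longrightarrow> run R e c \<sigma> B \<sigma>'" "\<not> bval R e \<sigma> b \<Longrightarrow> run R e c' \<sigma> B \<sigma>'"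
  shows "run R e (Cond b c c') \<sigma> (1 + bcost b + B) \<sigma>'"
  using assms unfolding run_def by (meson add_le_mono exec.CondFalse exec.CondTrue le_refl)

text \<open>The counter \<open>k\<close> is assumed to be \<open>0\<close> on entry and reset to \<open>0\<close> on exit. All subprograms below
  treat their auxiliary registers in this way, so that their effect is an explicit update of the
  state.\<close>

definition For :: "nat \<Rightarrow> nat \<Rightarrow> cmd \<Rightarrow> cmd" where
  "For k b c = Seq
     (While (NLess (Mem (Num k)) (Mem (Num b))) (Seq c (NAssign (Num k) (NAdd (Mem (Num k)) (Num 1)))))
     (NAssign (Num k) (Num 0))"

text \<open>The invariant is an exact state: \<open>f i\<close> is the state after \<open>i\<close>
  rounds, apart from the counter. A round costs the body, 6 for the test and 6 for the increment;
  the extra round in \<open>Suc N\<close> pays for the last test and the reset.\<close>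

lemma run_For:
  assumes step: "\<And>i. i < N \<Longrightarrow> run R e c (setn k i (f i)) B (setn k i (f (Suc i)))"
    and b: "\<And>i. i \<le> N \<Longrightarrow> nmem (f i) b = N" "b \<noteq> k"
    and k: "nmem (f 0) k = 0" "nmem (f N) k = 0"
  shows "run R e (For k b c) (f 0) (Suc N * (B + 12)) (f N)"
proof -
  let ?W = "While (NLess (Mem (Num k)) (Mem (Num b))) (Seq c (NAssign (Num k) (NAdd (Mem (Num k)) (Num 1))))"
  have "run R e ?W (setn k i (f i)) (6 + (N - i) * (B + 12)) (setn k N (f N))" if "i \<le> N" for i
    using that
  proof (induction "N - i" arbitrary: i)
    case 0
    then have i: "i = N" by simp
    have "\<not> bval R e (setn k N (f N)) (NLess (Mem (Num k)) (Mem (Num b)))" using b by simp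
    then show ?case unfolding run_def i
      by (intro exI[of _ "1 + bcost (NLess (Mem (Num k)) (Mem (Num b)))"] conjI exec.WhileFalse) simp_all
  next
    case (Suc j)
    then have i: "i < N" "j = N - Suc i" by auto
    have bv: "bval R e (setn k i (f i)) (NLess (Mem (Num k)) (Mem (Num b)))" using b i by simp
    have "run R e (Seq c (NAssign (Num k) (NAdd (Mem (Num k)) (Num 1)))) (setn k i (f i))
        (B + 6) (setn k (Suc i) (f (Suc i)))"
      by (rule run_weaken[OF run_Seq[OF step[OF i(1)] run_NAssign]]) (auto intro!: state_eqI)
    moreover have "run R e ?W (setn k (Suc i) (f (Suc i))) (6 + (N - Suc i) * (B + 12)) (setn k N (f N))"
      using Suc.hyps(1)[OF i(2)] i by simp
    ultimately obtain t t' where t: "t \<le> B + 6" "t' \<le> 6 + (N - Suc i) * (B + 12)"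
      "exec R e (Seq c (NAssign (Num k) (NAdd (Mem (Num k)) (Num 1)))) (setn k i (f i)) t (setn k (Suc i) (f (Suc i)))"
      "exec R e ?W (setn k (Suc i) (f (Suc i))) t' (setn k N (f N))"
      unfolding run_def by blast
    have "N - i = Suc (N - Suc i)" using i by simp
    then have "1 + bcost (NLess (Mem (Num k)) (Mem (Num b))) + t + t' \<le> 6 + (N - i) * (B + 12)"
      using t(1,2) by simp
    then show ?case unfolding run_def using exec.WhileTrue[OF bv t(3,4)] by blast
  qed
  from this[of 0] have "run R e ?W (setn k 0 (f 0)) (6 + N * (B + 12)) (setn k N (f N))" by simp
  moreover have "setn k 0 (f 0) = f 0" using k by (auto intro!: state_eqI)
  ultimately have "run R e ?W (f 0) (6 + N * (B + 12)) (setn k N (f N))" by simp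
  from run_Seq[OF this run_NAssign[of R e k "Num 0"]] show ?thesis
    unfolding For_def by (rule run_weaken) (use k in \<open>auto intro!: state_eqI\<close>)
qed

text \<open>All costs are kept as powers of one number \<open>N \<ge> 100\<close> that also bounds
  every loop, so a loop just adds 2 to the exponent and constants are absorbed.\<close>

lemma run_For_power:
  assumes step: "\<And>i. i < K \<Longrightarrow> run R e c (setn k i (f i)) (N ^ a) (setn k i (f (Suc i)))"
    and "\<And>i. i \<le> K \<Longrightarrow> nmem (f i) b = K" "b \<noteq> k" "nmem (f 0) k = 0" "nmem (f K) k = 0"
    and N: "K \<le> N" "100 \<le> N" and a: "1 \<le> a"
  shows "run R e (For k b c) (f 0) (N ^ (a + 2)) (f K)"
proof (rule run_weaken[OF run_For[OF assms(1-5)]])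
  have "12 \<le> N ^ a" using self_le_power[of N a] N a by simp
  then have "Suc K * (N ^ a + 12) \<le> (2 * N) * (2 * N ^ a)" using N by (intro mult_mono) auto
  also have "\<dots> = 4 * N ^ (a + 1)" by simp
  also have "\<dots> \<le> N * N ^ (a + 1)" using N by (intro mult_right_mono) auto
  finally show "Suc K * (N ^ a + 12) \<le> N ^ (a + 2)" by simp
qed auto

lemma power_bound: "100 \<le> N \<Longrightarrow> c \<le> 100 \<Longrightarrow> x \<le> c * N ^ a \<Longrightarrow> a < b \<Longrightarrow> x \<le> (N::nat) ^ b"
proof -
  assume "100 \<le> N" "c \<le> 100" "x \<le> c * N ^ a" "a < b"
  then have "x \<le> N * N ^ a" by (meson le_trans mult_le_mono1)
  also have "\<dots> = N ^ Suc a" by simp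
  also have "\<dots> \<le> N ^ b" using \<open>100 \<le> N\<close> \<open>a < b\<close> by (intro power_increasing) auto
  finally show ?thesis .
qed

abbreviation "reg k \<equiv> Mem (Num k)"

text \<open>Register allocation: \<open>0\<close> to \<open>3\<close> hold \<open>n\<close>, \<open>s\<close>, \<open>d\<close>, \<open>\<Delta>\<close>; \<open>5\<close> the radix \<open>M\<close>; \<open>8\<close> the number \<open>N\<close> of
  parameters; \<open>9\<close> and \<open>10\<close> hold \<open>\<Delta> + 1\<close> and \<open>d + 1\<close>; \<open>11\<close> to \<open>13\<close> are the counters \<open>r\<close>, \<open>t\<close>, \<open>i\<close> of the
  outer loops; \<open>15\<close> is the weight, \<open>18\<close> the modulus and \<open>19\<close> the power modulo it; the other registers
  from \<open>14\<close> to \<open>22\<close> are auxiliary.\<close>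

definition addto :: "nat \<Rightarrow> nat \<Rightarrow> nat \<Rightarrow> nat \<Rightarrow> cmd" where
  "addto k b dst src = For k b (NAssign (Num dst) (NAdd (reg dst) (reg src)))"

text \<open>The machine has no multiplication of numbers; this is its substitute, by repeated
  addition.\<close>

lemma run_addto:
  assumes "nmem \<sigma> k = 0" "distinct [k, b, dst, src] \<or> (b = src \<and> distinct [k, b, dst])"
    and "nmem \<sigma> b \<le> N" "100 \<le> N"
  shows "run R e (addto k b dst src) \<sigma> (N ^ 3) (setn dst (nmem \<sigma> dst + nmem \<sigma> b * nmem \<sigma> src) \<sigma>)"
proof -
  define f where "f = (\<lambda>i. setn dst (nmem \<sigma> dst + i * nmem \<sigma> src) \<sigma>)"
  have loop: "run R e (addto k b dst src) (f 0) (N ^ (1 + 2)) (f (nmem \<sigma> b))"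
    unfolding addto_def
  proof (rule run_For_power[OF _ _ _ _ _ assms(3,4)])
    fix i
    show "run R e (NAssign (Num dst) (NAdd (reg dst) (reg src))) (setn k i (f i)) (N ^ 1) (setn k i (f (Suc i)))"
      by (rule run_weaken[OF run_NAssign]) (use assms in \<open>auto simp: f_def intro!: state_eqI\<close>)
  qed (use assms in \<open>auto simp: f_def\<close>)
  have "f 0 = \<sigma>" by (auto simp: f_def intro!: state_eqI)
  then show ?thesis by (intro run_weaken[OF loop[unfolded \<open>f 0 = \<sigma>\<close>]]) (auto simp: f_def numeral_3_eq_3)
qed

definition power_cmd :: "nat \<Rightarrow> nat \<Rightarrow> nat \<Rightarrow> cmd" where
  "power_cmd dst base ex = Seq (NAssign (Num dst) (Num 1)) (For 20 ex
     (Seq (addto 22 base 21 dst) (Seq (NAssign (Num dst) (reg 21)) (NAssign (Num 21) (Num 0)))))"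

lemma run_power_cmd:
  assumes z: "nmem \<sigma> 20 = 0" "nmem \<sigma> 21 = 0" "nmem \<sigma> 22 = 0"
    and d: "distinct [dst, base, ex, 20, 21, 22]"
    and N: "nmem \<sigma> base \<le> N" "nmem \<sigma> ex \<le> N" "100 \<le> N"
  shows "run R e (power_cmd dst base ex) \<sigma> (N ^ 7) (setn dst (nmem \<sigma> base ^ nmem \<sigma> ex) \<sigma>)"
proof -
  define f where "f = (\<lambda>i. setn dst (nmem \<sigma> base ^ i) \<sigma>)"
  have loop: "run R e (For 20 ex (Seq (addto 22 base 21 dst) (Seq (NAssign (Num dst) (reg 21)) (NAssign (Num 21) (Num 0)))))
     (f 0) (N ^ (4 + 2)) (f (nmem \<sigma> ex))"
  proof (rule run_For_power[OF _ _ _ _ _ N(2,3)])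
    fix i
    have 1: "run R e (addto 22 base 21 dst) (setn 20 i (f i)) (N ^ 3)
        (setn 21 (nmem \<sigma> base * nmem \<sigma> base ^ i) (setn 20 i (f i)))"
      by (rule run_weaken[OF run_addto[of _ _ _ _ _ N]]) (use z d N in \<open>auto simp: f_def\<close>)
    show "run R e (Seq (addto 22 base 21 dst) (Seq (NAssign (Num dst) (reg 21)) (NAssign (Num 21) (Num 0))))
        (setn 20 i (f i)) (N ^ 4) (setn 20 i (f (Suc i)))"
    proof (rule run_weaken[OF run_Seq[OF 1 run_Seq[OF run_NAssign run_NAssign]]])
      have "1 \<le> N ^ 3" using N by simp
      then show "N ^ 3 + (2 + ncost (reg 21) + (2 + ncost (Num 0))) \<le> N ^ 4"
        by (intro power_bound[OF N(3), of 10 _ 3]) auto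
    qed (use z d in \<open>auto simp: f_def intro!: state_eqI\<close>)
  qed (use z d in \<open>auto simp: f_def\<close>)
  have init: "run R e (NAssign (Num dst) (Num 1)) \<sigma> 3 (f 0)"
    by (rule run_weaken[OF run_NAssign]) (auto simp: f_def)
  show ?thesis
    unfolding power_cmd_def
  proof (rule run_weaken[OF run_Seq[OF init loop]])
    have "1 \<le> N ^ 6" using N by simp
    then show "3 + N ^ (4 + 2) \<le> N ^ 7" by (intro power_bound[OF N(3), of 10 _ 6]) auto
  qed (simp add: f_def)
qed


text \<open>The remainder is taken after every addition. The full power is exponentially large, and
  reducing it afterwards by subtractions would take too long.\<close>

definition modpow_cmd :: cmd where
  "modpow_cmd = Seq (NAssign (Num 19) (Num 1)) (For 20 13
     (Seq (For 22 10 (Seq (NAssign (Num 21) (NAdd (reg 21) (reg 19)))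
         (Cond (NLess (reg 21) (reg 18)) Skip (NAssign (Num 21) (NSub (reg 21) (reg 18))))))
       (Seq (NAssign (Num 19) (reg 21)) (NAssign (Num 21) (Num 0)))))"

text \<open>Two remainders sum to less than \<open>2 * p\<close>, so one conditional subtraction
  suffices.\<close>

lemma mod_add_step:
  fixes p :: nat
  assumes "2 \<le> p"
  shows "(let y = a mod p + b mod p in if y < p then y else y - p) = (a + b) mod p"
proof -
  have "a mod p < p" "b mod p < p" using assms by auto
  then have "a mod p + b mod p - p < p" by linarith
  then show ?thesis
    using mod_add_eq[of a p b] by (auto simp: Let_def not_less le_mod_geq)
qed

lemma run_modpow_cmd:
  assumes z: "nmem \<sigma> 20 = 0" "nmem \<sigma> 21 = 0" "nmem \<sigma> 22 = 0"
    and p: "2 \<le> nmem \<sigma> 18"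
    and N: "nmem \<sigma> 10 \<le> N" "nmem \<sigma> 13 \<le> N" "100 \<le> N"
  shows "run R e modpow_cmd \<sigma> (N ^ 7) (setn 19 (nmem \<sigma> 10 ^ nmem \<sigma> 13 mod nmem \<sigma> 18) \<sigma>)"
proof -
  define B p where "B = nmem \<sigma> 10" and "p = nmem \<sigma> 18"
  have p2: "2 \<le> p" using p by (simp add: p_def)
  let ?add = "Seq (NAssign (Num 21) (NAdd (reg 21) (reg 19)))
         (Cond (NLess (reg 21) (reg 18)) Skip (NAssign (Num 21) (NSub (reg 21) (reg 18))))"
  have add: "run R e ?add \<tau> (N ^ 1) (setn 21 ((a + b) mod p) \<tau>)"
    if \<tau>: "nmem \<tau> 21 = a mod p" "nmem \<tau> 19 = b mod p" "nmem \<tau> 18 = p" for \<tau> a b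
  proof -
    let ?\<tau> = "setn 21 (a mod p + b mod p) \<tau>"
    have "run R e (Cond (NLess (reg 21) (reg 18)) Skip (NAssign (Num 21) (NSub (reg 21) (reg 18)))) ?\<tau>
        (1 + bcost (NLess (reg 21) (reg 18)) + 10) (setn 21 ((a + b) mod p) \<tau>)"
    proof (rule run_Cond)
      assume "bval R e ?\<tau> (NLess (reg 21) (reg 18))"
      then show "run R e Skip ?\<tau> 10 (setn 21 ((a + b) mod p) \<tau>)"
        using mod_add_step[OF p2, of a b] \<tau> by (intro run_weaken[OF run_Skip]) (auto simp: Let_def)
    next
      assume "\<not> bval R e ?\<tau> (NLess (reg 21) (reg 18))"
      then show "run R e (NAssign (Num 21) (NSub (reg 21) (reg 18))) ?\<tau> 10 (setn 21 ((a + b) mod p) \<tau>)"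
        using mod_add_step[OF p2, of a b] \<tau>
        by (intro run_weaken[OF run_NAssign]) (auto simp: Let_def intro!: state_eqI)
    qed
    moreover have "run R e (NAssign (Num 21) (NAdd (reg 21) (reg 19))) \<tau> 10 ?\<tau>"
      by (rule run_weaken[OF run_NAssign]) (use \<tau> in auto)
    ultimately show ?thesis
      by (intro run_weaken[OF run_Seq]) (use N in auto)
  qed
  define f where "f = (\<lambda>i. setn 19 (B ^ i mod p) \<sigma>)"
  have loop: "run R e (For 20 13 (Seq (For 22 10 ?add) (Seq (NAssign (Num 19) (reg 21)) (NAssign (Num 21) (Num 0)))))
     (f 0) (N ^ (4 + 2)) (f (nmem \<sigma> 13))"
  proof (rule run_For_power[OF _ _ _ _ _ N(2,3)])
    fix i
    \<comment> \<open>Register 21 accumulates the multiples while register 19 keeps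
      \<open>B ^ i mod p\<close> fixed.\<close>
    define h where "h = (\<lambda>l. setn 21 (l * B ^ i mod p) (setn 20 i (f i)))"
    have inner: "run R e (For 22 10 ?add) (h 0) (N ^ (1 + 2)) (h B)"
    proof (rule run_For_power[OF _ _ _ _ _ _ N(3)])
      fix l
      show "run R e ?add (setn 22 l (h l)) (N ^ 1) (setn 22 l (h (Suc l)))"
        by (rule run_weaken[OF add[of _ "l * B ^ i" "B ^ i"]])
          (auto simp: h_def f_def p_def add.commute intro!: state_eqI)
    qed (use z N in \<open>auto simp: h_def f_def B_def\<close>)
    have h0: "h 0 = setn 20 i (f i)" by (auto simp: h_def f_def z intro!: state_eqI)
    show "run R e (Seq (For 22 10 ?add) (Seq (NAssign (Num 19) (reg 21)) (NAssign (Num 21) (Num 0))))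
        (setn 20 i (f i)) (N ^ 4) (setn 20 i (f (Suc i)))"
    proof (rule run_weaken[OF run_Seq[OF inner[unfolded h0] run_Seq[OF run_NAssign run_NAssign]]])
      have pow3: "N ^ (1 + 2) = N ^ 3" by (simp add: numeral_3_eq_3)
      have "1 \<le> N ^ 3" using N by simp
      then show "N ^ (1 + 2) + (2 + ncost (reg 21) + (2 + ncost (Num 0))) \<le> N ^ 4"
        by (subst pow3, intro power_bound[OF N(3), of 10 _ 3]) auto
    qed (use z in \<open>auto simp: f_def h_def intro!: state_eqI\<close>)
  qed (use z in \<open>auto simp: f_def\<close>)
  \<comment> \<open>The start value 1 is a remainder already because
    \<open>2 \<le> p\<close>.\<close>
  have init: "run R e (NAssign (Num 19) (Num 1)) \<sigma> 3 (f 0)"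
    by (rule run_weaken[OF run_NAssign]) (use p2 in \<open>auto simp: f_def\<close>)
  show ?thesis
    unfolding modpow_cmd_def
  proof (rule run_weaken[OF run_Seq[OF init loop]])
    have "1 \<le> N ^ 6" using N by simp
    then show "3 + N ^ (4 + 2) \<le> N ^ 7" by (intro power_bound[OF N(3), of 10 _ 6]) auto
  qed (simp add: f_def B_def p_def)
qed

text \<open>Division with remainder by repeated subtraction. The loop runs \<open>N\<close> times
  regardless and idles once the remainder is reached; the quotient replaces the dividend, ready for
  the next digit.\<close>

definition digit_cmd :: cmd where
  "digit_cmd = Seq (For 20 8 (Cond (NLess (reg 14) (reg 5)) Skip
        (Seq (NAssign (Num 14) (NSub (reg 14) (reg 5))) (NAssign (Num 17) (NAdd (reg 17) (Num 1))))))
     (Seq (NAssign (Num 18) (NAdd (reg 14) (Num 2)))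
       (Seq (NAssign (Num 14) (reg 17)) (NAssign (Num 17) (Num 0))))"

lemma run_digit_cmd:
  assumes z: "nmem \<sigma> 20 = 0" "nmem \<sigma> 17 = 0"
    and x: "nmem \<sigma> 14 \<le> N" "0 < nmem \<sigma> 5" and N: "nmem \<sigma> 8 = N" "100 \<le> N"
  shows "run R e digit_cmd \<sigma> (N ^ 4)
    (setn 18 (nmem \<sigma> 14 mod nmem \<sigma> 5 + 2) (setn 14 (nmem \<sigma> 14 div nmem \<sigma> 5) \<sigma>))"
proof -
  define x M where "x = nmem \<sigma> 14" and "M = nmem \<sigma> 5"
  have M: "0 < M" using x by (simp add: M_def)
  \<comment> \<open>The number of subtractions actually made in the first \<open>i\<close>
    rounds.\<close>
  define q where "q = (\<lambda>i. min i (x div M))"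
  define f where "f = (\<lambda>i. setn 14 (x - q i * M) (setn 17 (q i) \<sigma>))"
  let ?body = "Cond (NLess (reg 14) (reg 5)) Skip
        (Seq (NAssign (Num 14) (NSub (reg 14) (reg 5))) (NAssign (Num 17) (NAdd (reg 17) (Num 1))))"
  have done_iff: "x - q i * M < M \<longleftrightarrow> x div M \<le> i" for i
  proof (cases "x div M \<le> i")
    case True
    then have "q i = x div M" by (simp add: q_def)
    then show ?thesis using True M by (simp add: minus_div_mult_eq_mod)
  next
    case False
    then have q: "q i = i" "Suc i \<le> x div M" by (auto simp: q_def)
    then have "Suc i * M \<le> x div M * M" by (intro mult_right_mono) auto
    also have "\<dots> \<le> x" by simp
    finally show ?thesis using False q by simp
  qed
  have loop: "run R e (For 20 8 ?body) (f 0) (N ^ (1 + 2)) (f N)"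
  proof (rule run_For_power[OF _ _ _ _ _ order.refl N(2)])
    fix i
    show "run R e ?body (setn 20 i (f i)) (N ^ 1) (setn 20 i (f (Suc i)))"
    proof (rule run_weaken[OF run_Cond])
      show "run R e Skip (setn 20 i (f i)) 20 (setn 20 i (f (Suc i)))"
        if "bval R e (setn 20 i (f i)) (NLess (reg 14) (reg 5))"
      proof -
        have "x div M \<le> i" using that done_iff[of i] by (simp add: f_def M_def)
        then have "f (Suc i) = f i" by (simp add: f_def q_def)
        then show ?thesis by (intro run_weaken[OF run_Skip]) auto
      qed
      show "run R e (Seq (NAssign (Num 14) (NSub (reg 14) (reg 5))) (NAssign (Num 17) (NAdd (reg 17) (Num 1))))
          (setn 20 i (f i)) 20 (setn 20 i (f (Suc i)))"
        if "\<not> bval R e (setn 20 i (f i)) (NLess (reg 14) (reg 5))"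
      proof -
        have "q i = i" "q (Suc i) = Suc i" using that done_iff[of i] by (auto simp: f_def M_def q_def)
        then show ?thesis
          by (intro run_weaken[OF run_Seq[OF run_NAssign run_NAssign]])
            (auto simp: f_def M_def add.commute intro!: state_eqI)
      qed
    qed (use N in auto)
  qed (use z N in \<open>auto simp: f_def q_def\<close>)
  have f0: "f 0 = \<sigma>" by (auto simp: f_def q_def x_def z intro!: state_eqI)
  have "x div M \<le> N" using x(1) by (auto simp: x_def intro: le_trans[OF div_le_dividend])
  then have fN: "f N = setn 14 (x mod M) (setn 17 (x div M) \<sigma>)"
    by (simp add: f_def q_def minus_div_mult_eq_mod)
  show ?thesis
    unfolding digit_cmd_def
  proof (rule run_weaken[OF run_Seq[OF loop[unfolded f0 fN] run_Seq[OF run_NAssign run_Seq[OF run_NAssign run_NAssign]]]])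
    have pow3: "N ^ (1 + 2) = N ^ 3" by (simp add: numeral_3_eq_3)
    have "1 \<le> N ^ 3" using N by simp
    then show "N ^ (1 + 2) + (2 + ncost (NAdd (reg 14) (Num 2)) + (2 + ncost (reg 17) + (2 + ncost (Num 0)))) \<le> N ^ 4"
      by (subst pow3, intro power_bound[OF N(2), of 20 _ 3]) auto
  qed (use z in \<open>auto simp: x_def M_def intro!: state_eqI\<close>)
qed

text \<open>The shift by 2 turns digits in base \<open>M\<close> into moduli from 2 to
  \<open>M + 1\<close>, so every number \<open>r\<close> encodes a valid sequence.\<close>

definition digits :: "nat \<Rightarrow> nat \<Rightarrow> nat \<Rightarrow> nat" where
  "digits M r j = r div M ^ j mod M + 2"

lemma exists_digits:
  assumes "\<And>j. p j \<in> {2..M + 1}"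
  shows "\<exists>r<M ^ k. \<forall>j<k. digits M r j = p j"
proof (induction k)
  case (Suc k)
  then obtain r where r: "r < M ^ k" "\<And>j. j < k \<Longrightarrow> digits M r j = p j" by blast
  have M: "0 < M" using assms[of 0] by simp
  \<comment> \<open>The new modulus becomes the leading digit, which leaves the lower ones
    alone.\<close>
  define c where "c = p k - 2"
  have c: "c < M" "p k = c + 2" using assms[of k] by (auto simp: c_def)
  have "r + c * M ^ k < M ^ k + c * M ^ k" using r(1) by simp
  also have "\<dots> = Suc c * M ^ k" by simp
  also have "\<dots> \<le> M * M ^ k" using c(1) by (intro mult_right_mono) auto
  finally have "r + c * M ^ k < M ^ Suc k" by simp
  moreover have "digits M (r + c * M ^ k) j = p j" if "j < Suc k" for j
  proof (cases "j = k")
    case True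
    then show ?thesis using r(1) c M by (simp add: digits_def)
  next
    case False
    define i where "i = k - Suc j"
    have k: "k = Suc i + j" using False that by (simp add: i_def)
    have "(r + c * M ^ k) div M ^ j = r div M ^ j + c * M ^ i * M"
      using M by (simp add: k power_add mult.assoc[symmetric])
    then show ?thesis using r(2)[of j] False that by (simp add: digits_def)
  qed
  ultimately show ?case by blast
qed simp

text \<open>The recursion of \<open>wt\<close> is a Horner scheme in \<open>M\<close>; it consumes
  the moduli in the order in which the lowest digits of \<open>r\<close> are split off.\<close>

definition weight_cmd :: cmd where
  "weight_cmd = Seq (NAssign (Num 15) (Num 1)) (Seq (NAssign (Num 14) (reg 11)) (Seq
     (For 16 9 (Seq digit_cmd (Seq modpow_cmd (Seq (addto 22 5 19 15) (Seq (NAssign (Num 15) (reg 19))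
       (Seq (NAssign (Num 18) (Num 0)) (NAssign (Num 19) (Num 0))))))))
     (NAssign (Num 14) (Num 0))))"

lemma run_weight_cmd:
  assumes z: "\<And>k. 14 \<le> k \<Longrightarrow> nmem \<sigma> k = 0"
    and N: "nmem \<sigma> 8 = N" "100 \<le> N" "\<And>k. k < 14 \<Longrightarrow> nmem \<sigma> k \<le> N" and M: "0 < nmem \<sigma> 5"
  shows "run R e weight_cmd \<sigma> (N ^ 11)
    (setn 15 (wt (nmem \<sigma> 5) (nmem \<sigma> 10) (digits (nmem \<sigma> 5) (nmem \<sigma> 11)) (nmem \<sigma> 9) (nmem \<sigma> 13)) \<sigma>)"
proof -
  define M r w where "M = nmem \<sigma> 5" and "r = nmem \<sigma> 11"
    and "w = (\<lambda>k. wt M (nmem \<sigma> 10) (digits M r) k (nmem \<sigma> 13))"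
  define f where "f = (\<lambda>k. setn 14 (r div M ^ k) (setn 15 (w k) \<sigma>))"
  have pow1: "1 \<le> N ^ a" for a using N by simp
  have MN: "M \<le> N" using N(3)[of 5] by (simp add: M_def)
  let ?body = "Seq digit_cmd (Seq modpow_cmd (Seq (addto 22 5 19 15) (Seq (NAssign (Num 15) (reg 19))
       (Seq (NAssign (Num 18) (Num 0)) (NAssign (Num 19) (Num 0))))))"
  have loop: "run R e (For 16 9 ?body) (f 0) (N ^ (8 + 2)) (f (nmem \<sigma> 9))"
  proof (rule run_For_power[OF _ _ _ _ _ _ N(2)])
    fix k
    have rM: "r div M ^ k \<le> N" using N(3)[of 11] by (auto simp: r_def intro: le_trans[OF div_le_dividend])
    let ?s0 = "setn 16 k (f k)"
    let ?s1 = "setn 18 (digits M r k) (setn 14 (r div M ^ Suc k) ?s0)"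
    let ?s2 = "setn 19 (nmem \<sigma> 10 ^ nmem \<sigma> 13 mod digits M r k) ?s1"
    let ?s3 = "setn 19 (w (Suc k)) ?s2"
    have 1: "run R e digit_cmd ?s0 (N ^ 4) ?s1"
      by (rule run_weaken[OF run_digit_cmd[of _ N]])
        (use z N M rM in \<open>auto simp: f_def M_def[symmetric] digits_def div_mult2_eq mult.commute[of M]\<close>)
    have 2: "run R e modpow_cmd ?s1 (N ^ 7) ?s2"
      by (rule run_weaken[OF run_modpow_cmd[of _ N]])
        (use z N in \<open>auto simp: f_def digits_def\<close>)
    have 3: "run R e (addto 22 5 19 15) ?s2 (N ^ 3) ?s3"
      by (rule run_weaken[OF run_addto[of _ _ _ _ _ N]])
        (use z N MN in \<open>auto simp: f_def w_def M_def[symmetric] algebra_simps intro!: state_eqI\<close>)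
    show "run R e ?body (setn 16 k (f k)) (N ^ 8) (setn 16 k (f (Suc k)))"
    proof (rule run_weaken[OF run_Seq[OF 1 run_Seq[OF 2 run_Seq[OF 3 run_Seq[OF run_NAssign run_Seq[OF run_NAssign run_NAssign]]]]]])
      have "N ^ 4 \<le> N ^ 7" "N ^ 3 \<le> N ^ 7" using N by (auto intro!: power_increasing)
      then show "N ^ 4 + (N ^ 7 + (N ^ 3 + (2 + ncost (reg 19) + (2 + ncost (Num 0) + (2 + ncost (Num 0)))))) \<le> N ^ 8"
        using pow1[of 7] by (intro power_bound[OF N(2), of 20 _ 7]) auto
    qed (use z in \<open>auto simp: f_def intro!: state_eqI\<close>)
  qed (use z N in \<open>auto simp: f_def\<close>)
  have init: "run R e (NAssign (Num 14) (reg 11)) (setn 15 1 \<sigma>) 4 (f 0)"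
    by (rule run_weaken[OF run_NAssign]) (auto simp: f_def w_def r_def)
  show ?thesis
    unfolding weight_cmd_def
  proof (rule run_weaken[OF run_Seq[OF run_NAssign run_Seq[OF _ run_Seq[OF loop run_NAssign]]]])
    show "run R e (NAssign (Num 14) (reg 11)) (setn 15 (nval \<sigma> (Num 1)) \<sigma>) 4 (f 0)" using init by simp
    show "2 + ncost (Num 1) + (4 + (N ^ (8 + 2) + (2 + ncost (Num 0)))) \<le> N ^ 11"
      using pow1[of 10] by (intro power_bound[OF N(2), of 20 _ 10]) auto
  qed (use z in \<open>auto simp: f_def w_def M_def r_def intro!: state_eqI\<close>)
qed


text \<open>The power is formed by as many multiplications as its exponent, which is affordable
  because the weights are at most \<open>N\<close>.\<close>

definition coordinate_cmd :: cmd where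
  "coordinate_cmd = Seq weight_cmd (Seq (FAssign (Num 0) FOne) (Seq
     (For 20 15 (FAssign (Num 0) (FMul (FMem (Num 0)) (Elem (reg 12)))))
     (Seq (Emit (FMem (Num 0))) (Seq (FAssign (Num 0) FZero) (NAssign (Num 15) (Num 0))))))"

text \<open>The number \<open>r\<close> encodes the moduli in base \<open>M\<close>; \<open>e t\<close> is the parameter of the curve.\<close>

definition curve_point :: "'a ring \<Rightarrow> (nat \<Rightarrow> 'a) \<Rightarrow> nat \<Rightarrow> nat \<Rightarrow> nat \<Rightarrow> nat \<Rightarrow> nat \<Rightarrow> nat \<Rightarrow> 'a list" where
  "curve_point R e M B L n r t = map (\<lambda>i. e t [^]\<^bsub>R\<^esub> wt M B (digits M r) L i) [0..<n]"

lemma run_coordinate_cmd: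
  fixes R :: "'a ring" and e :: "nat \<Rightarrow> 'a" and \<sigma> :: "'a state"
  defines "w \<equiv> wt (nmem \<sigma> 5) (nmem \<sigma> 10) (digits (nmem \<sigma> 5) (nmem \<sigma> 11)) (nmem \<sigma> 9) (nmem \<sigma> 13)"
  assumes "field R" and z: "\<And>k. 14 \<le> k \<Longrightarrow> nmem \<sigma> k = 0" "fmem \<sigma> 0 = \<zero>\<^bsub>R\<^esub>"
    and N: "nmem \<sigma> 8 = N" "100 \<le> N" "\<And>k. k < 14 \<Longrightarrow> nmem \<sigma> k \<le> N" and M: "0 < nmem \<sigma> 5"
    and w: "w \<le> N"
  shows "run R e coordinate_cmd \<sigma> (N ^ 12) (out [e (nmem \<sigma> 12) [^]\<^bsub>R\<^esub> w] \<sigma>)"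
proof -
  interpret field R by fact
  define f where "f = (\<lambda>j :: nat. setf (e (nmem \<sigma> 12) [^]\<^bsub>R\<^esub> j) (setn 15 w \<sigma>))"
  have pow1: "1 \<le> N ^ a" for a using N by simp
  have 1: "run R e weight_cmd \<sigma> (N ^ 11) (setn 15 w \<sigma>)"
    unfolding w_def by (rule run_weight_cmd) (use z N M in auto)
  have 2: "run R e (FAssign (Num 0) FOne) (setn 15 w \<sigma>) 3 (f 0)"
    by (rule run_weaken[OF run_FAssign]) (auto simp: f_def)
  have 3: "run R e (For 20 15 (FAssign (Num 0) (FMul (FMem (Num 0)) (Elem (reg 12))))) (f 0) (N ^ (1 + 2)) (f w)"
  proof (rule run_For_power[OF _ _ _ _ _ w N(2)])
    fix j
    show "run R e (FAssign (Num 0) (FMul (FMem (Num 0)) (Elem (reg 12)))) (setn 20 j (f j)) (N ^ 1)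
        (setn 20 j (f (Suc j)))"
      by (rule run_weaken[OF run_FAssign]) (use N in \<open>auto simp: f_def intro!: state_eqI\<close>)
  qed (use z in \<open>auto simp: f_def\<close>)
  show ?thesis
    unfolding coordinate_cmd_def
  proof (rule run_weaken[OF run_Seq[OF 1 run_Seq[OF 2 run_Seq[OF 3 run_Seq[OF run_Emit run_Seq[OF run_FAssign run_NAssign]]]]]])
    have "N ^ (1 + 2) \<le> N ^ 11" using N by (intro power_increasing) auto
    then have "N ^ 11 + (3 + (N ^ (1 + 2) + (1 + fcost (FMem (Num 0)) + (2 + fcost FZero + (2 + ncost (Num 0)))))) \<le> 20 * N ^ 11"
      using pow1[of 11] by (simp del: power_Suc)
    then show "N ^ 11 + (3 + (N ^ (1 + 2) + (1 + fcost (FMem (Num 0)) + (2 + fcost FZero + (2 + ncost (Num 0)))))) \<le> N ^ 12"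
      by (rule power_bound[OF N(2), rotated]) auto
  qed (use z in \<open>auto simp: f_def intro!: state_eqI\<close>)
qed

text \<open>The body is required to work for any output \<open>xs\<close> written so far, so that
  the rule can be nested.\<close>

lemma run_For_out:
  assumes z: "nmem \<sigma> k = 0" "b \<noteq> k" and N: "nmem \<sigma> b \<le> N" "100 \<le> N" "1 \<le> a"
    and step: "\<And>i xs. i < nmem \<sigma> b \<Longrightarrow>
      run R e c (out xs (setn k i \<sigma>)) (N ^ a) (out (g i) (out xs (setn k i \<sigma>)))"
  shows "run R e (For k b c) \<sigma> (N ^ (a + 2)) (out (concat (map g [0..<nmem \<sigma> b])) \<sigma>)"
proof -
  define f where "f = (\<lambda>i. out (concat (map g [0..<i])) \<sigma>)"
  have loop: "run R e (For k b c) (f 0) (N ^ (a + 2)) (f (nmem \<sigma> b))"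
  proof (rule run_For_power[OF _ _ _ _ _ N])
    fix i assume i: "i < nmem \<sigma> b"
    have "setn k i (f i) = out (concat (map g [0..<i])) (setn k i \<sigma>)"
      by (auto simp: f_def intro!: state_eqI)
    then show "run R e c (setn k i (f i)) (N ^ a) (setn k i (f (Suc i)))"
      by (simp only:) (rule run_weaken[OF step[OF i]], auto simp: f_def intro!: state_eqI)
  qed (use z in \<open>auto simp: f_def\<close>)
  have "f 0 = \<sigma>" by (auto simp: f_def intro!: state_eqI)
  then show ?thesis using loop unfolding \<open>f 0 = \<sigma>\<close> by (simp add: f_def)
qed

text \<open>Loops over \<open>r\<close>, \<open>t\<close> and \<open>i\<close>. Letting
  \<open>r\<close> run up to \<open>N\<close> instead of \<open>M ^ (\<Delta> + 1)\<close> saves a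
  register; larger \<open>r\<close> repeat earlier curves.\<close>

definition points_cmd :: cmd where
  "points_cmd = For 11 8 (For 12 8 (For 13 0 coordinate_cmd))"

lemma run_points_cmd:
  fixes R :: "'a ring" and e :: "nat \<Rightarrow> 'a" and \<sigma> :: "'a state"
  defines "pt \<equiv> curve_point R e (nmem \<sigma> 5) (nmem \<sigma> 10) (nmem \<sigma> 9) (nmem \<sigma> 0)"
  assumes "field R" and z: "\<And>k. 11 \<le> k \<Longrightarrow> nmem \<sigma> k = 0" "fmem \<sigma> 0 = \<zero>\<^bsub>R\<^esub>"
    and N: "nmem \<sigma> 8 = N" "100 \<le> N" "\<And>k. k < 14 \<Longrightarrow> nmem \<sigma> k \<le> N"
    and M: "3 \<le> nmem \<sigma> 5" "nmem \<sigma> 5 ^ Suc (nmem \<sigma> 9) \<le> N"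
  shows "run R e points_cmd \<sigma> (N ^ 18) (out (concat (map (\<lambda>r. concat (map (pt r) [0..<N])) [0..<N])) \<sigma>)"
proof -
  \<comment> \<open>The bound of \<open>wt_le\<close> has a factor 3, which one further factor of
    the radix in register 5 covers.\<close>
  have w: "wt (nmem \<sigma> 5) B (digits (nmem \<sigma> 5) r) (nmem \<sigma> 9) i \<le> N" for B r i
  proof -
    have "wt (nmem \<sigma> 5) B (digits (nmem \<sigma> 5) r) (nmem \<sigma> 9) i + 2 \<le> 3 * nmem \<sigma> 5 ^ nmem \<sigma> 9"
    proof (rule wt_le)
      have "x mod nmem \<sigma> 5 < nmem \<sigma> 5" for x using M(1) by simp
      then show "digits (nmem \<sigma> 5) r j \<le> Suc (nmem \<sigma> 5)" for j by (simp add: digits_def Suc_le_eq)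
    qed (use M in \<open>auto simp: digits_def\<close>)
    also have "\<dots> \<le> nmem \<sigma> 5 * nmem \<sigma> 5 ^ nmem \<sigma> 9" using M(1) by (rule mult_right_mono) simp
    finally show ?thesis using M(2) by simp
  qed
  have coord: "run R e coordinate_cmd (out xs (setn 13 i \<tau>)) (N ^ 12)
      (out [e (nmem \<tau> 12) [^]\<^bsub>R\<^esub> wt (nmem \<sigma> 5) (nmem \<sigma> 10) (digits (nmem \<sigma> 5) (nmem \<tau> 11)) (nmem \<sigma> 9) i]
        (out xs (setn 13 i \<tau>)))"
    if "i < nmem \<sigma> 0" "nmem \<tau> 11 < N" "nmem \<tau> 12 < N" "fmem \<tau> 0 = \<zero>\<^bsub>R\<^esub>"
      "\<And>k. k \<noteq> 11 \<Longrightarrow> k \<noteq> 12 \<Longrightarrow> nmem \<tau> k = nmem \<sigma> k" for xs i \<tau>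
  proof (rule run_weaken[OF run_coordinate_cmd[OF assms(2)]])
    fix k :: nat assume "k < 14"
    then show "nmem (out xs (setn 13 i \<tau>)) k \<le> N"
      using that N(3)[of k] N(3)[of 0] by (cases "k = 11"; cases "k = 12") auto
  qed (use that z N M w in auto)
  have point: "run R e (For 13 0 coordinate_cmd) (out xs (setn 12 t \<tau>)) (N ^ (12 + 2))
      (out (pt (nmem \<tau> 11) t) (out xs (setn 12 t \<tau>)))"
    if "t < N" "nmem \<tau> 11 < N" "fmem \<tau> 0 = \<zero>\<^bsub>R\<^esub>" "\<And>k. k \<noteq> 11 \<Longrightarrow> nmem \<tau> k = nmem \<sigma> k" for xs t \<tau>
  proof (rule run_weaken[OF run_For_out[where g = "\<lambda>i. [e t [^]\<^bsub>R\<^esub> wt (nmem \<sigma> 5) (nmem \<sigma> 10) (digits (nmem \<sigma> 5) (nmem \<tau> 11)) (nmem \<sigma> 9) i]"]])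
    fix i ys assume i: "i < nmem (out xs (setn 12 t \<tau>)) 0"
    show "run R e coordinate_cmd (out ys (setn 13 i (out xs (setn 12 t \<tau>)))) (N ^ 12)
        (out [e t [^]\<^bsub>R\<^esub> wt (nmem \<sigma> 5) (nmem \<sigma> 10) (digits (nmem \<sigma> 5) (nmem \<tau> 11)) (nmem \<sigma> 9) i]
          (out ys (setn 13 i (out xs (setn 12 t \<tau>)))))"
      by (rule run_weaken[OF coord]) (use that i in auto)
  qed (use that z N in \<open>auto simp: pt_def curve_point_def\<close>)
  have curve: "run R e (For 12 8 (For 13 0 coordinate_cmd)) (out xs (setn 11 r \<sigma>)) (N ^ (14 + 2))
      (out (concat (map (pt r) [0..<N])) (out xs (setn 11 r \<sigma>)))" if "r < N" for xs r
  proof (rule run_weaken[OF run_For_out[where g = "pt r" and a = 14]])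
    fix t ys assume t: "t < nmem (out xs (setn 11 r \<sigma>)) 8"
    show "run R e (For 13 0 coordinate_cmd) (out ys (setn 12 t (out xs (setn 11 r \<sigma>)))) (N ^ 14)
        (out (pt r t) (out ys (setn 12 t (out xs (setn 11 r \<sigma>)))))"
      by (rule run_weaken[OF point]) (use that t z N in auto)
  qed (use that z N in auto)
  show ?thesis
    unfolding points_cmd_def
  proof (rule run_weaken[OF run_For_out[where a = 16 and N = N]])
    fix r xs assume "r < nmem \<sigma> 8"
    then show "run R e (For 12 8 (For 13 0 coordinate_cmd)) (out xs (setn 11 r \<sigma>)) (N ^ 16)
        (out (concat (map (pt r) [0..<N])) (out xs (setn 11 r \<sigma>)))"
      by (intro run_weaken[OF curve]) (use N in auto)
  qed (use z N in auto)
qed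

text \<open>For \<open>n = s = d = 1\<close> the allowed time is a constant whatever
  \<open>\<Delta>\<close> is, so this case has to stop at once with a single point.\<close>

definition hitting_cmd :: cmd where
  "hitting_cmd = Cond (NLess (NAdd (reg 0) (NAdd (reg 1) (reg 2))) (Num 4)) (Emit FOne)
    (Seq (NAssign (Num 4) (NAdd (reg 0) (NAdd (reg 1) (NAdd (reg 2) (Num 2)))))
    (Seq (NAssign (Num 6) (Num 8))
    (Seq (NAssign (Num 7) (NAdd (reg 3) (Num 2)))
    (Seq (NAssign (Num 9) (NAdd (reg 3) (Num 1)))
    (Seq (NAssign (Num 10) (NAdd (reg 2) (Num 1)))
    (Seq (power_cmd 5 4 6) (Seq (power_cmd 8 5 7) points_cmd)))))))"

text \<open>With \<open>v = n + s + d + 2\<close>, the largest modulus times \<open>d\<close> is at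
  most \<open>2 * v ^ 7\<close>, hence below \<open>v ^ 8\<close>.\<close>

definition radix :: "nat \<Rightarrow> nat \<Rightarrow> nat \<Rightarrow> nat" where
  "radix n s d = (n + s + d + 2) ^ 8"

text \<open>After \<open>\<Delta> + 1\<close> rounds a variable weighs less than
  \<open>3 * M ^ (\<Delta> + 1)\<close>. The last factor \<open>M\<close> exceeds
  \<open>3 * d\<close> and so accounts for the degree.\<close>

definition num_params :: "nat \<Rightarrow> nat \<Rightarrow> nat \<Rightarrow> nat \<Rightarrow> nat" where
  "num_params n s d \<Delta> = radix n s d ^ (\<Delta> + 2)"

text \<open>The third bound covers every register set before the loops, except those holding the
  radix and \<open>N\<close> itself.\<close>

lemma num_params_ge:
  assumes "1 \<le> n" "1 \<le> s" "1 \<le> d"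
  shows "100 \<le> num_params n s d \<Delta>" "radix n s d \<le> num_params n s d \<Delta>"
    "n + s + d + \<Delta> + 8 \<le> num_params n s d \<Delta>" "100 \<le> radix n s d"
proof -
  define v where "v = n + s + d + 2"
  have v: "5 \<le> v" using assms by (simp add: v_def)
  have "100 \<le> (5::nat) ^ 8" by simp
  also have "\<dots> \<le> v ^ 8" using v by (rule power_mono) simp
  finally show M: "100 \<le> radix n s d" by (simp add: radix_def v_def)
  show MN: "radix n s d \<le> num_params n s d \<Delta>"
    unfolding num_params_def using M self_le_power[of "radix n s d" "\<Delta> + 2"] by simp
  then show "100 \<le> num_params n s d \<Delta>" using M by simp
  have "v \<le> radix n s d" unfolding radix_def v_def[symmetric] using v self_le_power[of v 8] by simp
  moreover have "\<Delta> < radix n s d ^ \<Delta>"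
    using less_exp[of \<Delta>] power_mono[of 2 "radix n s d" \<Delta>] M by linarith
  ultimately have "v + \<Delta> + 6 \<le> radix n s d + radix n s d ^ \<Delta> + 6" by linarith
  also have "\<dots> \<le> radix n s d ^ \<Delta> * radix n s d + radix n s d ^ \<Delta> * radix n s d + radix n s d ^ \<Delta> * radix n s d"
    using M by (intro add_mono) (auto intro: le_trans[of 6 "radix n s d"])
  also have "\<dots> = 3 * (radix n s d ^ \<Delta> * radix n s d)" by simp
  also have "\<dots> \<le> radix n s d * (radix n s d ^ \<Delta> * radix n s d)" using M by (intro mult_right_mono) auto
  also have "\<dots> = num_params n s d \<Delta>" by (simp add: num_params_def)
  finally show "n + s + d + \<Delta> + 8 \<le> num_params n s d \<Delta>" by (simp add: v_def)
qed

lemma run_hitting_cmd: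
  fixes R :: "'a ring" and n s d \<Delta> :: nat
  defines "N \<equiv> num_params n s d \<Delta>"
  assumes "field R" and nsd: "1 \<le> n" "1 \<le> s" "1 \<le> d" "4 \<le> n + s + d"
  shows "\<exists>\<sigma>'. run R e hitting_cmd (input_state R [n, s, d, \<Delta>]) (N ^ 19) \<sigma>' \<and>
    tape \<sigma>' = concat (map (\<lambda>r. concat (map (curve_point R e (radix n s d) (d + 1) (\<Delta> + 1) n r) [0..<N])) [0..<N])"
proof -
  let ?M = "radix n s d"
  note ge = num_params_ge(1-3)[OF nsd(1-3), of \<Delta>, folded N_def] num_params_ge(4)[OF nsd(1-3)]
  define \<sigma>0 where "\<sigma>0 = input_state R [n, s, d, \<Delta>]"
  have s0: "nmem \<sigma>0 0 = n" "nmem \<sigma>0 1 = s" "nmem \<sigma>0 (Suc 0) = s" "nmem \<sigma>0 2 = d" "nmem \<sigma>0 3 = \<Delta>" "\<And>k. 4 \<le> k \<Longrightarrow> nmem \<sigma>0 k = 0"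
    "fmem \<sigma>0 k = \<zero>\<^bsub>R\<^esub>" "tape \<sigma>0 = []" for k
    by (auto simp: \<sigma>0_def input_state_def nth_Cons numeral_2_eq_2 numeral_3_eq_3)
  define \<sigma>1 where "\<sigma>1 = setn 10 (d + 1) (setn 9 (\<Delta> + 1) (setn 7 (\<Delta> + 2) (setn 6 8 (setn 4 (n + s + d + 2) \<sigma>0))))"
  define \<sigma>2 where "\<sigma>2 = setn 8 N (setn 5 ?M \<sigma>1)"
  have s1: "nmem \<sigma>1 4 = n + s + d + 2" "nmem \<sigma>1 6 = 8" "nmem \<sigma>1 7 = \<Delta> + 2" "\<And>k. 11 \<le> k \<Longrightarrow> nmem \<sigma>1 k = 0"
    by (auto simp: \<sigma>1_def s0)
  have 1: "run R e (power_cmd 5 4 6) \<sigma>1 (N ^ 7) (setn 5 ?M \<sigma>1)"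
    by (rule run_weaken[OF run_power_cmd[of _ _ _ _ N]]) (use ge in \<open>auto simp: s1 radix_def\<close>)
  have 2: "run R e (power_cmd 8 5 7) (setn 5 ?M \<sigma>1) (N ^ 7) \<sigma>2"
    by (rule run_weaken[OF run_power_cmd[of _ _ _ _ N]])
      (use ge in \<open>auto simp: s1 \<sigma>2_def N_def num_params_def\<close>)
  let ?out = "concat (map (\<lambda>r. concat (map (curve_point R e ?M (d + 1) (\<Delta> + 1) n r) [0..<N])) [0..<N])"
  have regs: "nmem \<sigma>2 0 = n" "nmem \<sigma>2 5 = ?M" "nmem \<sigma>2 8 = N" "nmem \<sigma>2 9 = \<Delta> + 1" "nmem \<sigma>2 10 = d + 1"
    by (auto simp: \<sigma>2_def \<sigma>1_def s0)
  have 3: "run R e points_cmd \<sigma>2 (N ^ 18) (out ?out \<sigma>2)"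
  proof (rule run_weaken[OF run_points_cmd[OF assms(2), of _ N]])
    fix k :: nat
    have "k \<in> {0, 1, 2, 3} \<or> 4 \<le> k" by auto
    then have "nmem \<sigma>0 k \<le> N" using ge by (auto simp: s0)
    then show "nmem \<sigma>2 k \<le> N" using ge by (auto simp: \<sigma>2_def \<sigma>1_def)
  next
    show "nmem \<sigma>2 5 ^ Suc (nmem \<sigma>2 9) \<le> N" by (simp add: regs N_def num_params_def)
  qed (use ge in \<open>auto simp: regs s1 s0 \<sigma>2_def \<sigma>1_def\<close>)
  let ?v = "NAssign (Num 4) (NAdd (reg 0) (NAdd (reg 1) (NAdd (reg 2) (Num 2))))"
  have 0: "run R e ?v \<sigma>0 20 (setn 4 (n + s + d + 2) \<sigma>0)"
    by (rule run_weaken[OF run_NAssign]) (auto simp: s0 add.assoc)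
  have 4: "run R e (NAssign (Num 6) (Num 8)) (setn 4 (n + s + d + 2) \<sigma>0) 20 (setn 6 8 (setn 4 (n + s + d + 2) \<sigma>0))"
    by (rule run_weaken[OF run_NAssign]) auto
  have 5: "run R e (NAssign (Num 7) (NAdd (reg 3) (Num 2))) (setn 6 8 (setn 4 (n + s + d + 2) \<sigma>0)) 20
      (setn 7 (\<Delta> + 2) (setn 6 8 (setn 4 (n + s + d + 2) \<sigma>0)))"
    by (rule run_weaken[OF run_NAssign]) (auto simp: s0)
  have 6: "run R e (NAssign (Num 9) (NAdd (reg 3) (Num 1))) (setn 7 (\<Delta> + 2) (setn 6 8 (setn 4 (n + s + d + 2) \<sigma>0))) 20
      (setn 9 (\<Delta> + 1) (setn 7 (\<Delta> + 2) (setn 6 8 (setn 4 (n + s + d + 2) \<sigma>0))))"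
    by (rule run_weaken[OF run_NAssign]) (auto simp: s0)
  have 7: "run R e (NAssign (Num 10) (NAdd (reg 2) (Num 1)))
      (setn 9 (\<Delta> + 1) (setn 7 (\<Delta> + 2) (setn 6 8 (setn 4 (n + s + d + 2) \<sigma>0)))) 20 \<sigma>1"
    by (rule run_weaken[OF run_NAssign]) (auto simp: s0 \<sigma>1_def)
  note main = run_Seq[OF 0 run_Seq[OF 4 run_Seq[OF 5 run_Seq[OF 6 run_Seq[OF 7 run_Seq[OF 1 run_Seq[OF 2 3]]]]]]]
  have test: "\<not> bval R e \<sigma>0 (NLess (NAdd (reg 0) (NAdd (reg 1) (reg 2))) (Num 4))"
    using nsd(4) by (simp add: s0)
  have "run R e hitting_cmd \<sigma>0 (N ^ 19) (out ?out \<sigma>2)"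
    unfolding hitting_cmd_def
  proof (rule run_weaken[OF run_Cond[OF _ main]])
    have "N ^ 7 \<le> N ^ 18" using ge by (intro power_increasing) auto
    moreover have "1 \<le> N ^ 18" using ge by simp
    ultimately have "1 + bcost (NLess (NAdd (reg 0) (NAdd (reg 1) (reg 2))) (Num 4)) +
        (20 + (20 + (20 + (20 + (20 + (N ^ 7 + (N ^ 7 + N ^ 18))))))) \<le> 3 * N ^ 18 + 120 * 1" by simp
    also have "\<dots> \<le> 3 * N ^ 18 + 2 * N ^ 18"
      using ge(1) self_le_power[of N 18] by simp
    finally show "1 + bcost (NLess (NAdd (reg 0) (NAdd (reg 1) (reg 2))) (Num 4)) +
        (20 + (20 + (20 + (20 + (20 + (N ^ 7 + (N ^ 7 + N ^ 18))))))) \<le> N ^ 19"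
      by (intro power_bound[OF ge(1), of 5 _ 18]) auto
  qed (use test in auto)
  moreover have "tape (out ?out \<sigma>2) = ?out" by (simp add: \<sigma>2_def \<sigma>1_def s0)
  ultimately show ?thesis unfolding \<sigma>0_def by blast
qed

section \<open>The hitting set\<close>

lemma gate_list_of_circuit:
  fixes R :: "'a ring" (structure)
  assumes "field R" "is_circuit R n \<Psi>"
  shows "gate_list R (gates \<Psi>) n"
  using assms by (auto simp: gate_list_def gate_list_axioms_def is_circuit_def)

lemma unambiguous_gate_list_of_circuit:
  fixes R :: "'a ring" (structure)
  assumes "field R" "is_circuit R n \<Psi>" "unambiguous \<Psi>"
  shows "unambiguous_gate_list R (gates \<Psi>) n"
proof -
  interpret gate_list R "gates \<Psi>" n by (rule gate_list_of_circuit[OF assms(1,2)])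
  show ?thesis
  proof
    fix m
    show "\<exists>T. \<forall>g r. gen g r \<and> generated_monom r = m \<longrightarrow> rel_option same_tree r T"
      using assms(3) unfolding unambiguous_def gen_def by metis
  qed
qed

lemma separating_modulus_less_radix:
  assumes "1 \<le> n" "1 \<le> d"
  shows "2 * (Suc d * n * (n + s\<^sup>2)\<^sup>2) * d < radix n s d"
proof -
  define v where "v = n + s + d + 2"
  have "n + s\<^sup>2 \<le> v * v"
    by (simp add: v_def power2_eq_square algebra_simps)
  then have "(n + s\<^sup>2)\<^sup>2 \<le> (v * v)\<^sup>2" by (rule power_mono) simp
  then have "Suc d * n * (n + s\<^sup>2)\<^sup>2 * d \<le> v * v * (v * v)\<^sup>2 * v"
    by (intro mult_mono) (auto simp: v_def)
  then have "2 * (Suc d * n * (n + s\<^sup>2)\<^sup>2) * d \<le> 2 * (v * v * (v * v)\<^sup>2 * v)" by simp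
  also have "\<dots> < v * (v * v * (v * v)\<^sup>2 * v)"
    using assms by (intro mult_strict_right_mono) (auto simp: v_def)
  also have "\<dots> = v ^ 8" by (simp add: eval_nat_numeral)
  also have "\<dots> = radix n s d" by (simp only: radix_def v_def)
  finally show ?thesis .
qed

text \<open>The moduli found for the circuit are the digits of some \<open>r\<close>. On that curve
  \<open>f\<close> becomes a polynomial in \<open>t\<close> of degree below \<open>N\<close> with a
  nonzero coefficient, so one of \<open>N\<close> distinct parameters is not a root.\<close>

lemma curve_point_hits:
  fixes R :: "'a ring" (structure)
  assumes F: "field R" and nsd: "1 \<le> n" "1 \<le> s" "1 \<le> d"
    and e: "distinct_elements R (num_params n s d \<Delta>) e"
    and \<Psi>: "is_circuit R n \<Psi>" "unambiguous \<Psi>" "circuit_size \<Psi> \<le> s" "product_depth \<Psi> \<le> \<Delta>"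
    and f: "mpoly_nonzero R (circuit_poly R \<Psi>)" "mpoly_degree_le R (circuit_poly R \<Psi>) d"
  shows "\<exists>r<num_params n s d \<Delta>. \<exists>t<num_params n s d \<Delta>.
    mpoly_eval R (curve_point R e (radix n s d) (d + 1) (\<Delta> + 1) n r t) (circuit_poly R \<Psi>) \<noteq> \<zero>\<^bsub>R\<^esub>"
proof -
  interpret unambiguous_gate_list R "gates \<Psi>" n
    by (rule unambiguous_gate_list_of_circuit[OF F \<Psi>(1,2)])
  let ?M = "radix n s d" and ?N = "num_params n s d \<Delta>" and ?g = "out_gate \<Psi>"
  let ?Q = "2 * (Suc d * n * (n + s\<^sup>2)\<^sup>2)"
  have g: "?g < length (gates \<Psi>)" using \<Psi>(1) by (simp add: is_circuit_def)
  have f_eq: "circuit_poly R \<Psi> = cf ?g" by (simp add: circuit_poly_def cf_def)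
  have QM: "?Q * d < ?M" using separating_modulus_less_radix nsd by blast
  have "length (gates \<Psi>) \<le> s" "gate_values gate_depth (gates \<Psi>) ! ?g \<le> \<Delta>"
    using \<Psi>(3,4) by (auto simp: circuit_size_def product_depth_def)
  from exists_isolated_monom[OF nsd(1,3) this(1) QM g this(2) f[unfolded f_eq]]
  obtain p m where p: "\<And>j. p j \<in> {2..?Q}" and m: "cf ?g m \<noteq> \<zero>"
    "\<And>m'. cf ?g m' \<noteq> \<zero> \<Longrightarrow> wdeg (wt ?M (Suc d) p (Suc \<Delta>)) m' = wdeg (wt ?M (Suc d) p (Suc \<Delta>)) m \<Longrightarrow> m' = m"
    by blast
  have "?Q \<le> ?Q * d" using nsd(3) by simp
  then have pM: "p j \<in> {2..?M + 1}" for j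
    using p[of j] QM unfolding atLeastAtMost_iff by linarith
  obtain r where r: "r < ?M ^ Suc \<Delta>" "\<And>j. j < Suc \<Delta> \<Longrightarrow> digits ?M r j = p j"
    using exists_digits[of p ?M "Suc \<Delta>"] pM by blast
  define w where "w = wt ?M (d + 1) (digits ?M r) (\<Delta> + 1)"
  have w_eq: "w = wt ?M (Suc d) p (Suc \<Delta>)"
    using wt_cong[of "Suc \<Delta>" "digits ?M r" p ?M "Suc d"] r(2) by (auto simp: w_def)
  have M: "100 \<le> ?M" by (rule num_params_ge(4)[OF nsd])
  have "?M ^ Suc \<Delta> \<le> ?N" unfolding num_params_def using M by (intro power_increasing) auto
  with r(1) have rN: "r < ?N" by (rule less_le_trans)
  have wN: "wdeg w m < ?N" if "cf ?g m \<noteq> \<zero>" for m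
  proof -
    have w: "w i < 3 * ?M ^ Suc \<Delta>" for i
    proof -
      have "0 < p j" "p j \<le> Suc ?M" for j using pM[of j] by auto
      from wt_le[of ?M p "Suc d" "Suc \<Delta>" i, OF _ this] show ?thesis using M by (simp add: w_eq)
    qed
    have "wdeg w m \<le> 3 * ?M ^ Suc \<Delta> * size m" using w by (intro wdeg_le) (simp add: less_imp_le)
    also have "\<dots> \<le> 3 * ?M ^ Suc \<Delta> * d"
      using f(2) that by (intro mult_left_mono) (auto simp: f_eq mpoly_degree_le_def)
    also have "\<dots> = (3 * d) * ?M ^ Suc \<Delta>" by simp
    also have "\<dots> < ?M * ?M ^ Suc \<Delta>"
    proof (rule mult_strict_right_mono)
      have "3 * d < (n + s + d + 2) * (n + s + d + 2)" using nsd by (simp add: algebra_simps)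
      also have "\<dots> = (n + s + d + 2) ^ 2" by (simp add: power2_eq_square)
      also have "\<dots> \<le> ?M" unfolding radix_def by (rule power_increasing) auto
      finally show "3 * d < ?M" .
    qed (use M in auto)
    also have "\<dots> = ?N" by (simp add: num_params_def)
    finally show ?thesis .
  qed
  have "\<exists>t<?N. mpoly_eval R (map (\<lambda>i. e t [^] w i) [0..<n]) (cf ?g) \<noteq> \<zero>"
  proof (rule exists_nonzero_on_curve[OF F])
    show "finite {m. cf ?g m \<noteq> \<zero>}" using cf_finite_support[OF g] f(2) f_eq by simp
    show "set_mset m \<subseteq> {..<n}" if "cf ?g m \<noteq> \<zero>" for m
      using cf_nonzeroD[OF g that] gen_vars by blast
    show "m' = m" if "cf ?g m' \<noteq> \<zero>" "wdeg w m' = wdeg w m" for m'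
      using m(2)[folded w_eq] that by blast
    show "cf ?g m \<noteq> \<zero>" by (rule m(1))
    show "wdeg w m < ?N" if "cf ?g m \<noteq> \<zero>" for m using that by (rule wN)
  qed (use g e in \<open>auto simp: distinct_elements_def\<close>)
  then show ?thesis using rN unfolding f_eq curve_point_def w_def by blast
qed

text \<open>The only gate has no possible children, so it is a leaf and \<open>f\<close> a single
  term. At the point of all ones its value is its coefficient.\<close>

lemma single_gate_hit:
  fixes R :: "'a ring" (structure)
  assumes F: "field R" and \<Psi>: "is_circuit R n \<Psi>" "circuit_size \<Psi> \<le> 1"
    and f: "mpoly_nonzero R (circuit_poly R \<Psi>)"
  shows "mpoly_eval R (replicate n \<one>\<^bsub>R\<^esub>) (circuit_poly R \<Psi>) \<noteq> \<zero>\<^bsub>R\<^esub>"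
proof -
  interpret gate_list R "gates \<Psi>" n by (rule gate_list_of_circuit[OF F \<Psi>(1)])
  let ?g = "out_gate \<Psi>"
  have g: "?g < length (gates \<Psi>)" "?g = 0"
    using \<Psi> by (auto simp: is_circuit_def circuit_size_def)
  have f_eq: "circuit_poly R \<Psi> = cf ?g" by (simp add: circuit_poly_def cf_def)
  obtain m where m: "cf ?g m \<noteq> \<zero>" using f by (auto simp: f_eq mpoly_nonzero_def)
  have "{m. cf ?g m \<noteq> \<zero>} = {m}"
    using g(1)
  proof (cases rule: gate_cases)
    case (Plus js)
    then obtain j where "j \<in> set js" by (cases js) auto
    with Plus(3) g(2) show ?thesis by auto
  qed (use m g in \<open>auto simp: cf_Var cf_Const split: if_splits\<close>)
  moreover have "set_mset m' \<subseteq> {..<n}" if "cf ?g m' \<noteq> \<zero>" for m'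
    using cf_nonzeroD[OF g(1) that] gen_vars by blast
  \<comment> \<open>The point is read as a point of the curve with weight zero to reuse the
    evaluation formula.\<close>
  moreover have "replicate n \<one> = map (\<lambda>i. \<one> [^] (0 :: nat)) [0..<n]" by (simp add: map_replicate_trivial)
  ultimately show ?thesis
    using mpoly_eval_curve[OF F one_closed, of "cf ?g" n "\<lambda>_. 0"] m g(1) by (simp add: f_eq)
qed

text \<open>For \<open>u = n * d * s \<ge> 2\<close> one has
  \<open>n + s + d + 2 \<le> 5 * u \<le> u ^ 4\<close>, so the radix is at most
  \<open>u ^ 32\<close>. With exponents \<open>\<Delta> + 2 \<le> 3 * \<Delta>\<close> and 19 this
  gives \<open>32 * 3 * 19 = 1824\<close>.\<close>

lemma num_params_power_le:
  assumes "1 \<le> n" "1 \<le> s" "1 \<le> d" "1 \<le> \<Delta>" "2 \<le> n * d * s"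
  shows "num_params n s d \<Delta> ^ 19 \<le> (n * d * s) ^ (1824 * \<Delta>)"
proof -
  define u where "u = n * d * s"
  have "n * 1 * 1 \<le> u" "1 * d * 1 \<le> u" "1 * 1 * s \<le> u"
    unfolding u_def using assms by (intro mult_le_mono; simp)+
  then have "n \<le> u" "d \<le> u" "s \<le> u" unfolding mult_1 mult_1_right .
  moreover have u: "2 \<le> u" using assms(5) by (simp only: u_def)
  ultimately have "n + s + d + 2 \<le> 5 * u" by linarith
  also have "\<dots> \<le> u ^ 3 * u"
    using power_mono[of 2 u 3] u by (intro mult_right_mono) auto
  also have "\<dots> = u ^ 4" by (simp add: eval_nat_numeral)
  finally have "radix n s d \<le> (u ^ 4) ^ 8" unfolding radix_def by (rule power_mono) simp
  then have "num_params n s d \<Delta> \<le> ((u ^ 4) ^ 8) ^ (\<Delta> + 2)" unfolding num_params_def by (rule power_mono) simp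
  also have "\<dots> = u ^ (32 * (\<Delta> + 2))" by (simp only: power_mult[symmetric]) simp
  finally have "num_params n s d \<Delta> ^ 19 \<le> (u ^ (32 * (\<Delta> + 2))) ^ 19" by (rule power_mono) simp
  also have "\<dots> = u ^ (32 * (\<Delta> + 2) * 19)" by (simp only: power_mult[symmetric])
  also have "\<dots> \<le> u ^ (1824 * \<Delta>)" using assms(4) u by (intro power_increasing) auto
  finally show ?thesis by (simp add: u_def)
qed

lemma concat_concat_map: "concat (concat (map f xs)) = concat (map (\<lambda>x. concat (f x)) xs)"
  by (induction xs) auto

theorem mainTheorem6:
  "\<exists>(C::nat) (P::cmd). \<forall>(R::'a ring) (n::nat) (s::nat) (d::nat) (\<Delta>::nat) (e::nat \<Rightarrow> 'a).
     field R \<and> n \<ge> 1 \<and> s \<ge> 1 \<and> d \<ge> 1 \<and> \<Delta> \<ge> 1 \<and>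
     distinct_elements R (C * (n * d * s) ^ (C * \<Delta>)) e \<longrightarrow>
     (\<exists>H \<subseteq> points R n.
        (\<forall>\<Psi>. is_circuit R n \<Psi> \<and> unambiguous \<Psi> \<and> circuit_size \<Psi> \<le> s \<and> product_depth \<Psi> \<le> \<Delta> \<and>
              mpoly_nonzero R (circuit_poly R \<Psi>) \<and> mpoly_degree_le R (circuit_poly R \<Psi>) d \<longrightarrow>
              (\<exists>p\<in>H. mpoly_eval R p (circuit_poly R \<Psi>) \<noteq> \<zero>\<^bsub>R\<^esub>)) \<and>
        finite H \<and> card H \<le> C * (n * d * s) ^ (C * \<Delta>) \<and>
        constructs_within R e P [n, s, d, \<Delta>] n H (C * (n * d * s) ^ (C * \<Delta>)))"
\<comment> \<open>The exponent 1824 is that of \<open>num_params_power_le\<close>; as a factor it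
  pays for the case \<open>n * d * s = 1\<close>, where the power is 1.\<close>
proof (intro exI[of _ 1824] exI[of _ hitting_cmd] allI impI, elim conjE)
  fix R :: "'a ring" and n s d \<Delta> :: nat and e :: "nat \<Rightarrow> 'a"
  let ?B = "1824 * (n * d * s) ^ (1824 * \<Delta>)"
  assume F: "field R" and nsd: "1 \<le> n" "1 \<le> s" "1 \<le> d" and \<Delta>: "1 \<le> \<Delta>"
    and e: "distinct_elements R ?B e"
  interpret field R by fact
  show "\<exists>H \<subseteq> points R n.
        (\<forall>\<Psi>. is_circuit R n \<Psi> \<and> unambiguous \<Psi> \<and> circuit_size \<Psi> \<le> s \<and> product_depth \<Psi> \<le> \<Delta> \<and>
              mpoly_nonzero R (circuit_poly R \<Psi>) \<and> mpoly_degree_le R (circuit_poly R \<Psi>) d \<longrightarrow>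
              (\<exists>p\<in>H. mpoly_eval R p (circuit_poly R \<Psi>) \<noteq> \<zero>\<^bsub>R\<^esub>)) \<and>
        finite H \<and> card H \<le> ?B \<and> constructs_within R e hitting_cmd [n, s, d, \<Delta>] n H ?B"
  proof (cases "n + s + d < 4")
    case True
    then have 1: "n = 1" "s = 1" "d = 1" using nsd by auto
    let ?\<sigma> = "input_state R [n, s, d, \<Delta>]"
    have "bval R e ?\<sigma> (NLess (NAdd (reg 0) (NAdd (reg 1) (reg 2))) (Num 4))"
      by (simp add: 1 input_state_def numeral_2_eq_2)
    then have "run R e hitting_cmd ?\<sigma>
        (1 + bcost (NLess (NAdd (reg 0) (NAdd (reg 1) (reg 2))) (Num 4)) + 2) (out [\<one>\<^bsub>R\<^esub>] ?\<sigma>)"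
      unfolding hitting_cmd_def by (intro run_Cond run_weaken[OF run_Emit]) auto
    then have "run R e hitting_cmd ?\<sigma> ?B (out [\<one>\<^bsub>R\<^esub>] ?\<sigma>)"
      by (rule run_weaken) (auto simp: 1)
    then have "constructs_within R e hitting_cmd [n, s, d, \<Delta>] n {[\<one>\<^bsub>R\<^esub>]} ?B"
      unfolding constructs_within_def run_def
      by (elim exE conjE, intro exI[of _ "out [\<one>\<^bsub>R\<^esub>] ?\<sigma>"] exI[of _ "[[\<one>\<^bsub>R\<^esub>]]"] exI conjI)
        (auto simp: 1 input_state_def)
    moreover have "mpoly_eval R [\<one>\<^bsub>R\<^esub>] (circuit_poly R \<Psi>) \<noteq> \<zero>\<^bsub>R\<^esub>"
      if "is_circuit R n \<Psi>" "circuit_size \<Psi> \<le> s" "mpoly_nonzero R (circuit_poly R \<Psi>)" for \<Psi>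
      using single_gate_hit[OF F that(1) _ that(3)] that(2) 1 by simp
    ultimately show ?thesis
      by (intro exI[of _ "{[\<one>\<^bsub>R\<^esub>]}"]) (auto simp: points_def 1)
  next
    case False
    let ?N = "num_params n s d \<Delta>"
    let ?pt = "curve_point R e (radix n s d) (d + 1) (\<Delta> + 1) n"
    have nds: "2 \<le> n * d * s"
    proof (rule ccontr)
      assume "\<not> 2 \<le> n * d * s"
      moreover have "0 < n * d * s" using nsd by simp
      ultimately have "n * d * s = 1" by linarith
      then show False using False by simp
    qed
    have NB: "?N ^ 19 \<le> ?B" using num_params_power_le[OF nsd \<Delta> nds] by linarith
    have N: "100 \<le> ?N" by (rule num_params_ge(1)[OF nsd])
    have "?N \<le> ?N ^ 19" "?N ^ 2 \<le> ?N ^ 19" using N by (auto intro!: self_le_power power_increasing)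
    then have NB': "?N \<le> ?B" "?N ^ 2 \<le> ?B" using NB by linarith+
    have eN: "distinct_elements R ?N e"
      using e NB'(1) by (auto simp: distinct_elements_def intro: inj_on_subset)
    define ps where "ps = concat (map (\<lambda>r. map (?pt r) [0..<?N]) [0..<?N])"
    have ps: "set ps = (\<lambda>(r, t). ?pt r t) ` ({..<?N} \<times> {..<?N})" by (auto simp: ps_def)
    have "set ps \<subseteq> points R n"
      using eN by (force simp: ps points_def curve_point_def distinct_elements_def)
    moreover have "card (set ps) \<le> ?B"
    proof -
      have "card (set ps) \<le> card ({..<?N} \<times> {..<?N})" unfolding ps by (rule card_image_le) simp
      also have "\<dots> = ?N ^ 2" by (simp add: card_cartesian_product power2_eq_square)
      finally show ?thesis using NB'(2) by simp
    qed
    moreover have "\<exists>p\<in>set ps. mpoly_eval R p (circuit_poly R \<Psi>) \<noteq> \<zero>\<^bsub>R\<^esub>"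
      if "is_circuit R n \<Psi>" "unambiguous \<Psi>" "circuit_size \<Psi> \<le> s" "product_depth \<Psi> \<le> \<Delta>"
        "mpoly_nonzero R (circuit_poly R \<Psi>)" "mpoly_degree_le R (circuit_poly R \<Psi>) d" for \<Psi>
      using curve_point_hits[OF F nsd eN that] unfolding ps by force
    moreover have "constructs_within R e hitting_cmd [n, s, d, \<Delta>] n (set ps) ?B"
    proof -
      obtain \<sigma> where \<sigma>: "run R e hitting_cmd (input_state R [n, s, d, \<Delta>]) (?N ^ 19) \<sigma>"
        "tape \<sigma> = concat (map (\<lambda>r. concat (map (?pt r) [0..<?N])) [0..<?N])"
        using run_hitting_cmd[OF F nsd] False by (auto simp: not_less)
      then obtain t where t: "t \<le> ?N ^ 19" "exec R e hitting_cmd (input_state R [n, s, d, \<Delta>]) t \<sigma>"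
        by (auto simp: run_def)
      have "tape \<sigma> = concat ps" using \<sigma>(2) by (simp add: ps_def concat_concat_map)
      moreover have "\<forall>p\<in>set ps. length p = n" by (auto simp: ps curve_point_def)
      moreover have "t \<le> ?B" using t(1) NB by (rule le_trans)
      ultimately show ?thesis using t(2) unfolding constructs_within_def by blast
    qed
    ultimately show ?thesis by (intro exI[of _ "set ps"]) auto
  qed
qed

end
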